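(* Let $(X,d,\mu)$ be a metric measure space, let $\Omega\subset X$ be a bounded open set, let $G\subset\Omega$ be open, let $\nu$ be a Borel regular outer measure on $X$, and let $1\le p\le q<\infty$. (i) If there is a constant $\gamma$ such that $$\nu(F)^{p/q}\le\gamma\,\operatorname{con}_p(F,G,\Omega)$$ for every relatively closed subset $F$ of $\Omega$ with $F\subset G$, then there is a constant $c$, independent of $u$, such that $$\left(\int_\Omega|u|^q\,d\nu\right)^{1/q}\le c\left(\int_\Omega g_u^p\,d\mu\right)^{1/p}$$ for every $u\in N^{1,p}(\Omega)\cap C(\Omega)$ with $u=0$ in $\Omega\setminus G$ and every $p$-weak upper gradient $g_u$ of $u$ in $\Omega$. (ii) Conversely, if there is a constant $c$, independent of $u$, such that $$\left(\int_\Omega|u|^q\,d\nu\right)^{1/q}\le c\left(\int_\Omega g_u^p\,d\mu\right)^{1/p}$$ for every $u\in N^{1,p}(\Omega)\cap C(\Omega)$ with $u=0$ in $\Omega\setminus G$ and every $p$-weak upper gradient $g_u$ of $u$ in $\Omega$, then $$\nu(F)^{p/q}\le\gamma\,\operatorname{con}_p(F,G,\Omega)$$ for every relatively closed subset $F$ of $\Omega$ with $F\subset G$, with $\gamma=c^{\,p}$.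
   Context: $(X,d)$ is a metric space and $\mu$ is a Borel regular outer measure on $X$ with $0<\mu(B)<\infty$ for every ball $B=B(x,r)=\{y\in X: d(x,y)<r\}$. A path in $\Omega$ is a rectifiable non-constant continuous map from a compact interval to $\Omega$. A family $\Gamma$ of paths has zero $p$-modulus if there is a non-negative Borel function $\rho\in L^p(\Omega)$ with $\int_\gamma\rho\,ds=\infty$ for all $\gamma\in\Gamma$; a property holds for $p$-almost every path if the family of paths for which it fails has zero $p$-modulus. A non-negative measurable function $g$ on $\Omega$ is a $p$-weak upper gradient of a function $u$ on $\Omega$ if for $p$-almost every path $\gamma$ in $\Omega$, with endpoints $x,y$, one has $|u(x)-u(y)|\le\int_\gamma g\,ds$ whenever $u(x),u(y)$ are both finite, and $\int_\gamma g\,ds=\infty$ otherwise. $N^{1,p}(\Omega)$ is the space of $u\in L^p(\Omega,\mu)$ with $\|u\|_{N^{1,p}(\Omega)}=\left(\int_\Omega|u|^p\,d\mu+\inf_g\int_\Omega g^p\,d\mu\right)^{1/p}<\infty$ (infimum over $p$-weak upper gradients $g$ of $u$ in $\Omega$), modulo $u\sim v$ iff $\|u-v\|_{N^{1,p}(\Omega)}=0$. $C(\Omega)$ denotes the real-valued continuous functions on $\Omega$. For $F$ a relatively closed subset of $\Omega$ and $G\subset\Omega$ open with $F\subset G$, let $\mathcal B(F,G,\Omega)=\{u\in N^{1,p}(\Omega)\cap C(\Omega): u\ge1\text{ in }F,\ u\le0\text{ in }\Omega\setminus G\}$. The $p$-conductivity of the conductor $G\setminus F$ is $$\operatorname{con}_p(F,G,\Omega)=\inf_{u\in\mathcal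 B(F,G,\Omega)}\int_\Omega g_u^p\,d\mu,$$ the infimum being also over the $p$-weak upper gradients $g_u$ of $u$ in $\Omega$, and being $\infty$ if $\mathcal B(F,G,\Omega)=\emptyset$. *)

theory Defs
  imports "HOL-Analysis.Analysis"
begin

(* Intended for exponents p > 0, so that powers of infinity are infinity. *)
definition enn_powr :: "ennreal \<Rightarrow> real \<Rightarrow> ennreal" (infixr \<open>epowr\<close> 80) where
  "x epowr p = (if x = top then top else ennreal (enn2real x powr p))"

definition borel_regular_outer_measure :: "('a::topological_space set \<Rightarrow> ennreal) \<Rightarrow> bool" where
  "borel_regular_outer_measure \<mu> \<longleftrightarrow>
     outer_measure_space UNIV \<mu> \<and>
     sets borel \<subseteq> lambda_system UNIV UNIV \<mu> \<and>
     (\<forall>A. \<exists>B\<in>sets borel. A \<subseteq> B \<and> \<mu> B = \<mu> A)"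

definition metric_measure :: "('a::metric_space set \<Rightarrow> ennreal) \<Rightarrow> bool" where
  "metric_measure \<mu> \<longleftrightarrow>
     borel_regular_outer_measure \<mu> \<and>
     (\<forall>x r. 0 < r \<longrightarrow> 0 < \<mu> (ball x r) \<and> \<mu> (ball x r) < top)"

(* The restriction of an outer measure to its Caratheodory measurable sets. All
   integrals and all measurability "with respect to \<mu>" refer to this measure. *)
definition caratheodory_measure :: "('a set \<Rightarrow> ennreal) \<Rightarrow> 'a measure" where
  "caratheodory_measure \<mu> = measure_of UNIV (lambda_system UNIV UNIV \<mu>) \<mu>"

(* The supremum is over nondecreasing tuples t 0 \<le> ... \<le> t n in [a,b]; requiring the
   end points a, b to occur in them would not change it. *)
definition curve_length :: "real \<Rightarrow> real \<Rightarrow> (real \<Rightarrow> 'a::metric_space) \<Rightarrow> ennreal" where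
  "curve_length a b \<gamma> =
     (SUP (n, t) \<in> {(n, t). mono_on {..n} t \<and> t ` {..n} \<subseteq> {a..b}}.
        \<Sum>i<n. ennreal (dist (\<gamma> (t i)) (\<gamma> (t (Suc i)))))"

(* A curve is a triple (\<gamma>, a, b); only the values of \<gamma> on [a,b] matter. Non-constancy
   forces a < b. *)
definition paths_in :: "'a::metric_space set \<Rightarrow> ((real \<Rightarrow> 'a) \<times> real \<times> real) set" where
  "paths_in \<Omega> = {(\<gamma>, a, b).
     continuous_on {a..b} \<gamma> \<and> \<gamma> ` {a..b} \<subseteq> \<Omega> \<and>
     \<not> \<gamma> constant_on {a..b} \<and> curve_length a b \<gamma> < top}"

(* The point of the curve reached after arc length s. For 0 \<le> s \<le> length such a
   parameter t exists, and \<gamma> t does not depend on its choice. *)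
definition arclength_param :: "real \<Rightarrow> real \<Rightarrow> (real \<Rightarrow> 'a::metric_space) \<Rightarrow> real \<Rightarrow> 'a" where
  "arclength_param a b \<gamma> s = \<gamma> (SOME t. t \<in> {a..b} \<and> curve_length a t \<gamma> = ennreal s)"

definition path_integral ::
    "('a::metric_space \<Rightarrow> ennreal) \<Rightarrow> (real \<Rightarrow> 'a) \<times> real \<times> real \<Rightarrow> ennreal" where
  "path_integral g = (\<lambda>(\<gamma>, a, b).
     \<integral>\<^sup>+ s \<in> {0..enn2real (curve_length a b \<gamma>)}. g (arclength_param a b \<gamma> s) \<partial>lebesgue)"

definition zero_modulus ::
    "('a::metric_space set \<Rightarrow> ennreal) \<Rightarrow> real \<Rightarrow> 'a set \<Rightarrow> ((real \<Rightarrow> 'a) \<times> real \<times> real) set \<Rightarrow> bool" where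
  "zero_modulus \<mu> p \<Omega> \<Gamma> \<longleftrightarrow>
     (\<exists>\<rho> :: 'a \<Rightarrow> ennreal.
        \<rho> \<in> borel_measurable (restrict_space borel \<Omega>) \<and>
        (\<integral>\<^sup>+ x \<in> \<Omega>. \<rho> x epowr p \<partial>caratheodory_measure \<mu>) < top \<and>
        (\<forall>\<gamma>\<in>\<Gamma>. path_integral \<rho> \<gamma> = top))"

definition upper_gradient_ineq ::
    "('a::metric_space \<Rightarrow> ereal) \<Rightarrow> ('a \<Rightarrow> ennreal) \<Rightarrow> (real \<Rightarrow> 'a) \<times> real \<times> real \<Rightarrow> bool" where
  "upper_gradient_ineq u g = (\<lambda>(\<gamma>, a, b).
     if \<bar>u (\<gamma> a)\<bar> \<noteq> \<infinity> \<and> \<bar>u (\<gamma> b)\<bar> \<noteq> \<infinity>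
     then e2ennreal \<bar>u (\<gamma> a) - u (\<gamma> b)\<bar> \<le> path_integral g (\<gamma>, a, b)
     else path_integral g (\<gamma>, a, b) = top)"

(* Upper gradients may take the value infinity. As g is only \<mu>-measurable, it need not be
   measurable along every path, but the paths along which it fails to be measurable
   have zero p-modulus, so the value of path_integral on them is irrelevant. *)
definition weak_upper_gradients ::
    "('a::metric_space set \<Rightarrow> ennreal) \<Rightarrow> real \<Rightarrow> 'a set \<Rightarrow> ('a \<Rightarrow> ereal) \<Rightarrow> ('a \<Rightarrow> ennreal) set" where
  "weak_upper_gradients \<mu> p \<Omega> u =
     {g. g \<in> borel_measurable (restrict_space (caratheodory_measure \<mu>) \<Omega>) \<and>
         zero_modulus \<mu> p \<Omega> {\<gamma> \<in> paths_in \<Omega>. \<not> upper_gradient_ineq u g \<gamma>}}"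

definition energy :: "('a set \<Rightarrow> ennreal) \<Rightarrow> real \<Rightarrow> 'a set \<Rightarrow> ('a \<Rightarrow> ennreal) \<Rightarrow> ennreal" where
  "energy \<mu> p \<Omega> g = (\<integral>\<^sup>+ x \<in> \<Omega>. g x epowr p \<partial>caratheodory_measure \<mu>)"

definition N1p_norm ::
    "('a::metric_space set \<Rightarrow> ennreal) \<Rightarrow> real \<Rightarrow> 'a set \<Rightarrow> ('a \<Rightarrow> ereal) \<Rightarrow> ennreal" where
  "N1p_norm \<mu> p \<Omega> u =
     (energy \<mu> p \<Omega> (\<lambda>x. e2ennreal \<bar>u x\<bar>)
      + (INF g \<in> weak_upper_gradients \<mu> p \<Omega> u. energy \<mu> p \<Omega> g)) epowr (1 / p)"

(* The functions representing elements of the Newtonian space; finiteness of the norm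
   includes that u is p-integrable. Functions with N1p_norm (u - v) = 0 are not
   identified: only continuous representatives are used below, and those are unique
   because every ball has positive measure. *)
definition N1p :: "('a::metric_space set \<Rightarrow> ennreal) \<Rightarrow> real \<Rightarrow> 'a set \<Rightarrow> ('a \<Rightarrow> ereal) set" where
  "N1p \<mu> p \<Omega> =
     {u. u \<in> borel_measurable (restrict_space (caratheodory_measure \<mu>) \<Omega>) \<and>
         N1p_norm \<mu> p \<Omega> u < top}"

definition N1p_cont :: "('a::metric_space set \<Rightarrow> ennreal) \<Rightarrow> real \<Rightarrow> 'a set \<Rightarrow> ('a \<Rightarrow> real) set" where
  "N1p_cont \<mu> p \<Omega> = {u. (\<lambda>x. ereal (u x)) \<in> N1p \<mu> p \<Omega> \<and> continuous_on \<Omega> u}"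

definition admissible ::
    "('a::metric_space set \<Rightarrow> ennreal) \<Rightarrow> real \<Rightarrow> 'a set \<Rightarrow> 'a set \<Rightarrow> 'a set \<Rightarrow> ('a \<Rightarrow> real) set" where
  "admissible \<mu> p F G \<Omega> =
     {u \<in> N1p_cont \<mu> p \<Omega>. (\<forall>x\<in>F. 1 \<le> u x) \<and> (\<forall>x\<in>\<Omega> - G. u x \<le> 0)}"

(* An infimum over the empty set is infinity in ennreal. *)
definition conductivity ::
    "('a::metric_space set \<Rightarrow> ennreal) \<Rightarrow> real \<Rightarrow> 'a set \<Rightarrow> 'a set \<Rightarrow> 'a set \<Rightarrow> ennreal" where
  "conductivity \<mu> p F G \<Omega> =
     (INF u \<in> admissible \<mu> p F G \<Omega>.
        INF g \<in> weak_upper_gradients \<mu> p \<Omega> (\<lambda>x. ereal (u x)). energy \<mu> p \<Omega> g)"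

end

theory Submission
  imports Defs
begin

text \<open>
  The theorem is Maz'ya's characterisation of Sobolev type inequalities by isocapacitary
  inequalities, proved by truncation.

  From capacity to functions (lemma \<open>capacitary_strong_type_inequality\<close>): cut \<open>\<bar>u\<bar>\<close> at the dyadic
  levels. The normalised truncation of \<open>\<bar>u\<bar>\<close> between \<open>2 powr (k - 1)\<close> and \<open>2 powr k\<close> is a competitor
  for the conductivity of \<open>F k = {2 powr k \<le> \<bar>u\<bar>}\<close>, and its energy is at most
  \<open>2 powr ((1 - k) * p)\<close> times the energy \<open>a k\<close> of \<open>g\<close> on the layer between the two levels. The
  isocapacitary inequality thus bounds \<open>2 powr (k * q) * \<nu> (F k)\<close> by a constant times
  \<open>a k powr (q / p)\<close>. Summing over \<open>k\<close>, the left-hand sides control \<open>\<integral> \<bar>u\<bar> powr q d\<nu>\<close>, while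
  \<open>(\<Sum>k. a k powr (q / p)) \<le> (\<Sum>k. a k) powr (q / p)\<close> because \<open>p \<le> q\<close>, and \<open>\<Sum>k. a k\<close> is at most the
  energy of \<open>g\<close> because the layers are disjoint.

  From functions to capacity (lemma \<open>le_energy_of_admissible\<close>): test the Sobolev inequality with the
  positive part of a competitor, which is at least 1 on \<open>F\<close>. The passage to the infimum fails only
  for \<open>c = 0\<close> when there are no competitors, since then the right-hand side is \<open>0 * \<infinity> = 0\<close>; in this
  case \<open>\<nu> G = 0\<close>, as seen by testing with a Lipschitz function that is positive exactly on \<open>G\<close>
  (lemma \<open>null_if_sobolev_zero\<close>).

  What needs care is that the truncation has the restriction of \<open>g\<close> to the layer as a weak upper
  gradient (lemma \<open>weak_upper_gradient_truncate\<close>). No absolute continuity along paths enters: a path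
  on which the truncation changes from \<open>\<alpha>\<close> to \<open>\<beta>\<close> contains a subpath that stays inside the layer and
  on which \<open>u\<close> changes from \<open>\<alpha>\<close> to \<open>\<beta>\<close>, and the upper gradient inequality on this single subpath
  suffices. Subpaths are admissible here because a path containing a subpath of an exceptional
  family is itself exceptional. Both facts rest on the monotonicity of path integrals in the path
  (lemma \<open>path_integral_subpath\<close>), hence on the additivity and continuity of arc length.
\<close>

section \<open>Length of curves\<close>

lemma curve_length_upper:
  assumes "mono_on {..n} t" "t ` {..n} \<subseteq> {a..b}"
  shows "(\<Sum>i<n. ennreal (dist (\<gamma> (t i)) (\<gamma> (t (Suc i))))) \<le> curve_length a b \<gamma>"
  unfolding curve_length_def by (rule SUP_upper2[of "(n, t)"]) (use assms in auto)

lemma curve_length_least: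
  assumes "\<And>n t. mono_on {..n} t \<Longrightarrow> t ` {..n} \<subseteq> {a..b} \<Longrightarrow>
    (\<Sum>i<n. ennreal (dist (\<gamma> (t i)) (\<gamma> (t (Suc i))))) \<le> M"
  shows "curve_length a b \<gamma> \<le> M"
  unfolding curve_length_def by (rule SUP_least) (use assms in auto)

lemma curve_length_mono:
  assumes "a \<le> a'" "b' \<le> b"
  shows "curve_length a' b' \<gamma> \<le> curve_length a b \<gamma>"
proof (rule curve_length_least)
  fix n and t :: "nat \<Rightarrow> real"
  assume t: "mono_on {..n} t" "t ` {..n} \<subseteq> {a'..b'}"
  have "{a'..b'} \<subseteq> {a..b}"
    using assms by auto
  then show "(\<Sum>i<n. ennreal (dist (\<gamma> (t i)) (\<gamma> (t (Suc i))))) \<le> curve_length a b \<gamma>"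
    using t by (intro curve_length_upper) auto
qed

lemma dist_le_curve_length:
  assumes "a \<le> s" "s \<le> t" "t \<le> b"
  shows "ennreal (dist (\<gamma> s) (\<gamma> t)) \<le> curve_length a b \<gamma>"
proof -
  have "(\<Sum>i<1. ennreal (dist (\<gamma> (if i = 0 then s else t)) (\<gamma> (if Suc i = 0 then s else t))))
      \<le> curve_length a b \<gamma>"
    by (rule curve_length_upper) (use assms in \<open>auto simp: mono_on_def\<close>)
  then show ?thesis by simp
qed

lemma curve_length_same [simp]: "curve_length a a \<gamma> = 0"
proof -
  have "curve_length a a \<gamma> \<le> 0"
  proof (rule curve_length_least)
    fix n and t :: "nat \<Rightarrow> real"
    assume t: "mono_on {..n} t" "t ` {..n} \<subseteq> {a..a}"
    have "t i = a" if "i \<le> n" for i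
      using t(2) that by (auto simp: image_subset_iff)
    then show "(\<Sum>i<n. ennreal (dist (\<gamma> (t i)) (\<gamma> (t (Suc i))))) \<le> 0"
      by simp
  qed
  then show ?thesis by simp
qed

text \<open>A partition of the whole interval is cut at \<open>b\<close> by replacing each of its points \<open>x\<close> by
  \<open>min x b\<close> and by \<open>max x b\<close>; the one step that crosses \<open>b\<close> is handled by the triangle inequality.
  Conversely, partitions of the two halves are concatenated.\<close>

lemma curve_length_add:
  assumes "a \<le> b" "b \<le> c"
  shows "curve_length a c \<gamma> = curve_length a b \<gamma> + curve_length b c \<gamma>"
proof (rule antisym)
  show "curve_length a c \<gamma> \<le> curve_length a b \<gamma> + curve_length b c \<gamma>"
  proof (rule curve_length_least)
    fix n and t :: "nat \<Rightarrow> real"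
    assume t: "mono_on {..n} t" "t ` {..n} \<subseteq> {a..c}"
    let ?l = "\<lambda>i. min (t i) b" and ?r = "\<lambda>i. max (t i) b"
    have step: "dist (\<gamma> (t i)) (\<gamma> (t (Suc i))) \<le>
        dist (\<gamma> (?l i)) (\<gamma> (?l (Suc i))) + dist (\<gamma> (?r i)) (\<gamma> (?r (Suc i)))" if "i < n" for i
    proof -
      have "t i \<le> t (Suc i)"
        using t(1) that by (auto simp: mono_on_def)
      then consider "t (Suc i) \<le> b" | "b \<le> t i" | "t i \<le> b" "b \<le> t (Suc i)"
        by linarith
      then show ?thesis
        by cases (use \<open>t i \<le> t (Suc i)\<close> in \<open>auto simp: min_def max_def dist_triangle\<close>)
    qed
    have "(\<Sum>i<n. ennreal (dist (\<gamma> (t i)) (\<gamma> (t (Suc i)))))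
        \<le> (\<Sum>i<n. ennreal (dist (\<gamma> (?l i)) (\<gamma> (?l (Suc i)))) + ennreal (dist (\<gamma> (?r i)) (\<gamma> (?r (Suc i)))))"
      by (intro sum_mono) (use step in \<open>auto simp: ennreal_plus[symmetric] simp del: ennreal_plus\<close>)
    also have "\<dots> = (\<Sum>i<n. ennreal (dist (\<gamma> (?l i)) (\<gamma> (?l (Suc i)))))
        + (\<Sum>i<n. ennreal (dist (\<gamma> (?r i)) (\<gamma> (?r (Suc i)))))"
      by (rule sum.distrib)
    also have "\<dots> \<le> curve_length a b \<gamma> + curve_length b c \<gamma>"
    proof (intro add_mono curve_length_upper)
      show "mono_on {..n} ?l" "mono_on {..n} ?r"
        by (intro mono_onI max.mono min.mono order_refl mono_onD[OF t(1)]; simp)+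
      show "?l ` {..n} \<subseteq> {a..b}" "?r ` {..n} \<subseteq> {b..c}"
        using t(2) assms by auto
    qed
    finally show "(\<Sum>i<n. ennreal (dist (\<gamma> (t i)) (\<gamma> (t (Suc i)))))
        \<le> curve_length a b \<gamma> + curve_length b c \<gamma>" .
  qed
next
  have sum_split: "(\<Sum>i<n + k. f i) = (\<Sum>i<n. f i) + (\<Sum>i<k. f (n + i))" for n k and f :: "nat \<Rightarrow> ennreal"
    by (induction k) (simp_all add: add.assoc)
  have conc: "(\<Sum>i<n. ennreal (dist (\<gamma> (t i)) (\<gamma> (t (Suc i)))))
      + (\<Sum>i<m. ennreal (dist (\<gamma> (s i)) (\<gamma> (s (Suc i))))) \<le> curve_length a c \<gamma>"
    if t: "mono_on {..n} t" "t ` {..n} \<subseteq> {a..b}" and s: "mono_on {..m} s" "s ` {..m} \<subseteq> {b..c}"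
    for n m and t s :: "nat \<Rightarrow> real"
  proof -
    define r where "r i = (if i \<le> n then t i else s (i - Suc n))" for i
    let ?d = "\<lambda>i. ennreal (dist (\<gamma> (r i)) (\<gamma> (r (Suc i))))"
    have "(\<Sum>i<n + Suc m. ?d i) = (\<Sum>i<n. ?d i) + (\<Sum>i<Suc m. ?d (n + i))"
      by (rule sum_split)
    also have "(\<Sum>i<Suc m. ?d (n + i)) = ?d n + (\<Sum>i<m. ?d (n + Suc i))"
      by (subst sum.lessThan_Suc_shift) simp
    also have "(\<Sum>i<n. ?d i) = (\<Sum>i<n. ennreal (dist (\<gamma> (t i)) (\<gamma> (t (Suc i)))))"
      by (intro sum.cong) (auto simp: r_def)
    also have "(\<Sum>i<m. ?d (n + Suc i)) = (\<Sum>i<m. ennreal (dist (\<gamma> (s i)) (\<gamma> (s (Suc i)))))"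
      by (intro sum.cong) (auto simp: r_def)
    finally have eq: "(\<Sum>i<n + Suc m. ?d i) = (\<Sum>i<n. ennreal (dist (\<gamma> (t i)) (\<gamma> (t (Suc i)))))
        + (?d n + (\<Sum>i<m. ennreal (dist (\<gamma> (s i)) (\<gamma> (s (Suc i))))))" .
    have tb: "a \<le> t i" "t i \<le> b" if "i \<le> n" for i
      using t(2) that by (auto simp: image_subset_iff)
    have sb: "b \<le> s i" "s i \<le> c" if "i \<le> m" for i
      using s(2) that by (auto simp: image_subset_iff)
    have "(\<Sum>i<n + Suc m. ?d i) \<le> curve_length a c \<gamma>"
    proof (rule curve_length_upper)
      show "mono_on {..n + Suc m} r"
      proof (rule mono_onI)
        fix i j assume ij: "i \<in> {..n + Suc m}" "j \<in> {..n + Suc m}" "i \<le> j"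
        consider "j \<le> n" | "i \<le> n" "n < j" | "n < i"
          by linarith
        then show "r i \<le> r j"
        proof cases
          case 1 then show ?thesis using t(1) ij by (auto simp: r_def mono_on_def)
        next
          case 2
          then have "t i \<le> b" "b \<le> s (j - Suc n)" using tb sb ij by auto
          then show ?thesis using 2 by (simp add: r_def)
        next
          case 3
          then have "s (i - Suc n) \<le> s (j - Suc n)"
            by (intro mono_onD[OF s(1)]) (use ij in auto)
          then show ?thesis using 3 ij by (simp add: r_def)
        qed
      qed
      show "r ` {..n + Suc m} \<subseteq> {a..c}"
      proof safe
        fix i assume "i \<le> n + Suc m"
        then show "r i \<in> {a..c}"
          using tb[of i] sb[of "i - Suc n"] assms by (cases "i \<le> n") (auto simp: r_def intro: order_trans)
      qed
    qed
    then show ?thesis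
      unfolding eq by (rule order_trans[rotated]) (intro add_left_mono, simp)
  qed
  let ?P = "\<lambda>a b. {(n, t). mono_on {..n} t \<and> t ` {..n} \<subseteq> {a..b}} :: (nat \<times> (nat \<Rightarrow> real)) set"
  have ne: "?P x y \<noteq> {}" if "x \<le> y" for x y
  proof -
    have "(0, \<lambda>_. x) \<in> ?P x y"
      by (intro CollectI case_prodI conjI mono_onI order_refl) (use that in auto)
    then show ?thesis by blast
  qed
  have fst_fixed: "(\<Sum>i<n. ennreal (dist (\<gamma> (t i)) (\<gamma> (t (Suc i))))) + curve_length b c \<gamma>
      \<le> curve_length a c \<gamma>" if t: "mono_on {..n} t" "t ` {..n} \<subseteq> {a..b}" for n and t :: "nat \<Rightarrow> real"
    unfolding curve_length_def[of b c] ennreal_SUP_add_right[OF ne[OF assms(2)]]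
    by (rule SUP_least) (clarify, rule conc[OF t])
  show "curve_length a b \<gamma> + curve_length b c \<gamma> \<le> curve_length a c \<gamma>"
    unfolding curve_length_def[of a b] ennreal_SUP_add_left[symmetric, OF ne[OF assms(1)]]
    by (rule SUP_least) (clarify, rule fst_fixed)
qed

text \<open>Lower semicontinuity under exhaustion of the interval: moving the points of a partition of
  \<open>[a, b]\<close> into \<open>[c m, d m]\<close> changes its length by an amount tending to 0, as \<open>\<gamma>\<close> is
  continuous.\<close>

lemma curve_length_exhaust:
  assumes cont: "continuous_on {a..b} \<gamma>"
    and cd: "\<And>m. a \<le> c m" "\<And>m. c m \<le> d m" "\<And>m. d m \<le> b"
    and lim: "c \<longlonglongrightarrow> a" "d \<longlonglongrightarrow> b"
    and le: "\<And>m. curve_length (c m) (d m) \<gamma> \<le> M"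
  shows "curve_length a b \<gamma> \<le> M"
proof (rule curve_length_least)
  fix n and t :: "nat \<Rightarrow> real"
  assume t: "mono_on {..n} t" "t ` {..n} \<subseteq> {a..b}"
  define s where "s m i = max (c m) (min (t i) (d m))" for m i
  have conv: "(\<lambda>m. \<gamma> (s m i)) \<longlonglongrightarrow> \<gamma> (t i)" if "i \<le> n" for i
  proof -
    have ti: "t i \<in> {a..b}"
      using t(2) that by auto
    have "(\<lambda>m. s m i) \<longlonglongrightarrow> max a (min (t i) b)"
      unfolding s_def by (intro tendsto_intros lim)
    also have "max a (min (t i) b) = t i"
      using ti by auto
    finally have "(\<lambda>m. s m i) \<longlonglongrightarrow> t i" .
    moreover have "s m i \<in> {a..b}" for m
      using cd[of m] ti by (auto simp: s_def)
    ultimately show ?thesis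
      using ti continuous_on_tendsto_compose[OF cont, of "\<lambda>m. s m i" "t i" sequentially] by simp
  qed
  have conv_sum: "(\<lambda>m. \<Sum>i<n. ennreal (dist (\<gamma> (s m i)) (\<gamma> (s m (Suc i)))))
      \<longlonglongrightarrow> (\<Sum>i<n. ennreal (dist (\<gamma> (t i)) (\<gamma> (t (Suc i)))))"
    by (intro tendsto_intros conv) auto
  have "(\<Sum>i<n. ennreal (dist (\<gamma> (s m i)) (\<gamma> (s m (Suc i))))) \<le> M" for m
  proof -
    have "(\<Sum>i<n. ennreal (dist (\<gamma> (s m i)) (\<gamma> (s m (Suc i))))) \<le> curve_length (c m) (d m) \<gamma>"
    proof (rule curve_length_upper)
      show "mono_on {..n} (s m)"
        unfolding s_def by (intro mono_onI max.mono min.mono order_refl mono_onD[OF t(1)]) auto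
      show "s m ` {..n} \<subseteq> {c m..d m}"
        using cd[of m] by (auto simp: s_def)
    qed
    then show ?thesis using le[of m] by simp
  qed
  then show "(\<Sum>i<n. ennreal (dist (\<gamma> (t i)) (\<gamma> (t (Suc i))))) \<le> M"
    by (intro LIMSEQ_le_const2[OF conv_sum]) auto
qed

text \<open>The arc length function has no jumps. At the last parameter \<open>t\<close> up to which the length
  does not exceed \<open>s\<close>, the length of \<open>[a, t]\<close> is at most \<open>s\<close> by exhaustion from the left, and the
  length of \<open>[t, b]\<close> is at most the remaining length by exhaustion from the right.\<close>

lemma curve_length_attained:
  assumes cont: "continuous_on {a..b} \<gamma>" and "a \<le> b" and fin: "curve_length a b \<gamma> < top"
    and s: "0 \<le> s" "ennreal s \<le> curve_length a b \<gamma>"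
  shows "\<exists>t\<in>{a..b}. curve_length a t \<gamma> = ennreal s"
proof -
  define T where "T = {t \<in> {a..b}. curve_length a t \<gamma> \<le> ennreal s}"
  define t where "t = Sup T"
  have aT: "a \<in> T"
    using assms by (auto simp: T_def)
  have bdd: "bdd_above T"
    by (auto simp: T_def bdd_above_def)
  have tab: "a \<le> t" "t \<le> b"
    using aT bdd by (auto simp: t_def T_def intro!: cSup_upper cSup_least)
  have below: "curve_length a x \<gamma> \<le> ennreal s" if "x < t" for x
  proof -
    obtain y where "y \<in> T" "x < y"
      using less_cSupD[of T x] aT \<open>x < t\<close> by (auto simp: t_def)
    then show ?thesis
      using curve_length_mono[of a a x y \<gamma>] by (auto simp: T_def)
  qed
  have above: "ennreal s \<le> curve_length a x \<gamma>" if "t < x" "x \<le> b" for x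
  proof -
    have "x \<notin> T"
      using cSup_upper[OF _ bdd, of x] that by (auto simp: t_def)
    then show ?thesis
      using that tab by (auto simp: T_def)
  qed
  have small: "(\<lambda>m. K / real (Suc m)) \<longlonglongrightarrow> 0" for K
    by (rule LIMSEQ_Suc) (rule lim_const_over_n)
  have part: "0 < K / real (Suc m)" "K / real (Suc m) \<le> K" if "0 < K" for K m
    using that by (auto simp: divide_le_eq mult_le_cancel_left1)
  have le1: "curve_length a t \<gamma> \<le> ennreal s"
  proof (cases "t = a")
    case False
    then have at: "a < t" using tab by simp
    define d where "d m = t - (t - a) / real (Suc m)" for m
    show ?thesis
    proof (rule curve_length_exhaust[where c = "\<lambda>_. a" and d = d])
      show "continuous_on {a..t} \<gamma>"
        by (rule continuous_on_subset[OF cont]) (use tab in auto)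
      show "a \<le> d m" for m
        using part(2)[of "t - a" m] at by (simp add: d_def)
      show "d m \<le> t" for m
        using at by (auto simp: d_def)
      show "d \<longlonglongrightarrow> t"
        using tendsto_diff[OF tendsto_const[of t] small[of "t - a"]] by (simp add: d_def[abs_def])
      show "curve_length a (d m) \<gamma> \<le> ennreal s" for m
        using at by (intro below) (auto simp: d_def)
    qed auto
  qed simp
  have le2: "curve_length t b \<gamma> + ennreal s \<le> curve_length a b \<gamma>"
  proof (cases "t = b")
    case False
    then have tb: "t < b" using tab by simp
    define c where "c m = t + (b - t) / real (Suc m)" for m
    have cb: "t < c m" "c m \<le> b" for m
      using part[of "b - t" m] tb by (simp_all add: c_def)
    have "curve_length t b \<gamma> \<le> curve_length a b \<gamma> - ennreal s"
    proof (rule curve_length_exhaust[where c = c and d = "\<lambda>_. b"])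
      show "continuous_on {t..b} \<gamma>"
        by (rule continuous_on_subset[OF cont]) (use tab in auto)
      show "t \<le> c m" "c m \<le> b" for m
        using cb[of m] by auto
      show "c \<longlonglongrightarrow> t"
        using tendsto_add[OF tendsto_const[of t] small[of "b - t"]] by (simp add: c_def[abs_def])
      show "curve_length (c m) b \<gamma> \<le> curve_length a b \<gamma> - ennreal s" for m
      proof -
        have "curve_length (c m) b \<gamma> + ennreal s \<le> curve_length (c m) b \<gamma> + curve_length a (c m) \<gamma>"
          using above[OF cb] by (intro add_mono) auto
        also have "\<dots> = curve_length a b \<gamma>"
          using curve_length_add[of a "c m" b \<gamma>] cb[of m] tab by (simp add: add.commute)
        finally show ?thesis
          by (simp add: ennreal_le_minus_iff add.commute)
      qed
    qed auto
    then show ?thesis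
      using add_right_mono[of _ _ "ennreal s"] s(2) diff_add_cancel_ennreal by metis
  qed (use s in simp)
  have "ennreal s \<le> curve_length a t \<gamma>"
  proof -
    have "curve_length t b \<gamma> + ennreal s \<le> curve_length t b \<gamma> + curve_length a t \<gamma>"
      using le2 curve_length_add[of a t b \<gamma>] tab by (simp add: add.commute)
    moreover have "curve_length t b \<gamma> < top"
      using curve_length_mono[of a t b b \<gamma>] tab fin by (auto intro: le_less_trans)
    ultimately show ?thesis
      by (auto simp: ennreal_add_left_cancel_le)
  qed
  with le1 tab show ?thesis
    by (auto intro!: bexI[of _ t])
qed

lemma arclength_param_eq:
  assumes t: "t \<in> {a..b}" and s: "curve_length a t \<gamma> = ennreal s"
  shows "arclength_param a b \<gamma> s = \<gamma> t"
proof -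
  have same: "\<gamma> x = \<gamma> y"
    if "a \<le> x" "x \<le> y" "curve_length a x \<gamma> = ennreal s" "curve_length a y \<gamma> = ennreal s" for x y
  proof -
    have "ennreal s + curve_length x y \<gamma> = ennreal s + 0"
      using curve_length_add[of a x y \<gamma>] that by simp
    then have "curve_length x y \<gamma> = 0"
      by (simp only: ennreal_add_left_cancel) simp
    then show ?thesis
      using dist_le_curve_length[of x x y y \<gamma>] that by simp
  qed
  have "\<gamma> x = \<gamma> t" if "x \<in> {a..b} \<and> curve_length a x \<gamma> = ennreal s" for x
  proof (cases "x \<le> t")
    case True
    then show ?thesis using same[of x t] that s by auto
  next
    case False
    then show ?thesis using same[of t x] that t s by auto
  qed
  moreover have "(SOME t. t \<in> {a..b} \<and> curve_length a t \<gamma> = ennreal s) \<in> {a..b} \<and>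
      curve_length a (SOME t. t \<in> {a..b} \<and> curve_length a t \<gamma> = ennreal s) \<gamma> = ennreal s"
    by (rule someI[of "\<lambda>t. t \<in> {a..b} \<and> curve_length a t \<gamma> = ennreal s" t]) (intro conjI t s)
  ultimately show ?thesis
    unfolding arclength_param_def by blast
qed

section \<open>Integrals along paths\<close>

text \<open>Integrands along paths need not be measurable, so the integral is an inner integral:
  the supremum of the integrals of the measurable functions below. The following rule reduces
  estimates of such integrals to measurable functions.\<close>

lemma nn_integral_leI:
  assumes "\<And>s. s \<in> borel_measurable M \<Longrightarrow> s \<le> f \<Longrightarrow> integral\<^sup>N M s \<le> K"
  shows "integral\<^sup>N M f \<le> K"
  unfolding nn_integral_def
proof (rule SUP_least)
  fix s assume s: "s \<in> {g. simple_function M g \<and> g \<le> f}"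
  then have "integral\<^sup>S M s = integral\<^sup>N M s"
    by (simp add: nn_integral_eq_simple_integral)
  also have "\<dots> \<le> K"
    using s by (intro assms) (auto intro: borel_measurable_simple_function)
  finally show "integral\<^sup>S M s \<le> K" .
qed

lemma nn_integral_lebesgue_translate_le:
  fixes f :: "real \<Rightarrow> ennreal"
  shows "(\<integral>\<^sup>+x. f (c + x) \<partial>lebesgue) \<le> (\<integral>\<^sup>+x. f x \<partial>lebesgue)"
proof (rule nn_integral_leI)
  fix s :: "real \<Rightarrow> ennreal"
  assume s: "s \<in> borel_measurable lebesgue" "s \<le> (\<lambda>x. f (c + x))"
  have "integral\<^sup>N lebesgue s = (\<integral>\<^sup>+x. s (- c + x) \<partial>lebesgue)"
    using nn_integral_real_affine_lebesgue[OF s(1), of 1 "- c"] by simp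
  also have "\<dots> \<le> (\<integral>\<^sup>+x. f x \<partial>lebesgue)"
  proof (rule nn_integral_mono)
    show "s (- c + x) \<le> f x" for x
      using le_funD[OF s(2), of "- c + x"] by simp
  qed
  finally show "integral\<^sup>N lebesgue s \<le> (\<integral>\<^sup>+x. f x \<partial>lebesgue)" .
qed

lemma nn_integral_cmult_ge:
  "c * (\<integral>\<^sup>+x. f x \<partial>M) \<le> (\<integral>\<^sup>+x. c * f x \<partial>M)"
  unfolding nn_integral_def[of M f] SUP_mult_left_ennreal
proof (rule SUP_least)
  fix s assume s: "s \<in> {g. simple_function M g \<and> g \<le> f}"
  then have [measurable]: "s \<in> borel_measurable M"
    by (auto intro: borel_measurable_simple_function)
  have "c * integral\<^sup>S M s = (\<integral>\<^sup>+x. c * s x \<partial>M)"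
    using s by (simp add: nn_integral_eq_simple_integral[symmetric] nn_integral_cmult)
  also have "\<dots> \<le> (\<integral>\<^sup>+x. c * f x \<partial>M)"
    using s by (intro nn_integral_mono mult_left_mono) (auto simp: le_fun_def)
  finally show "c * integral\<^sup>S M s \<le> (\<integral>\<^sup>+x. c * f x \<partial>M)" .
qed

lemma path_integral_cmult_ge:
  "c * path_integral g \<gamma> \<le> path_integral (\<lambda>x. c * g x) \<gamma>"
  unfolding path_integral_def by (cases \<gamma>) (simp add: mult.assoc nn_integral_cmult_ge)

lemma path_integral_const:
  assumes "curve_length a b \<gamma> < top"
  shows "path_integral (\<lambda>_. c) (\<gamma>, a, b) = c * curve_length a b \<gamma>"
  unfolding path_integral_def prod.case
  by (subst nn_integral_cmult_indicator) (use assms in \<open>simp_all\<close>)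

text \<open>By additivity of length, the arc length parameter along a subpath is, up to a shift by the
  length of the initial piece, the one along the whole path. The open interval suffices in
  \<open>le\<close>: the endpoints \<open>a'\<close> and \<open>b'\<close> correspond to two values of arc length, a null set.\<close>

lemma path_integral_subpath:
  assumes cont: "continuous_on {a..b} \<gamma>" and fin: "curve_length a b \<gamma> < top"
    and sub: "a \<le> a'" "a' \<le> b'" "b' \<le> b"
    and le: "\<And>t. a' < t \<Longrightarrow> t < b' \<Longrightarrow> h (\<gamma> t) \<le> g (\<gamma> t)"
  shows "path_integral h (\<gamma>, a', b') \<le> path_integral g (\<gamma>, a, b)"
proof -
  define L L' L0 where "L = enn2real (curve_length a b \<gamma>)"
    and "L' = enn2real (curve_length a' b' \<gamma>)" and "L0 = enn2real (curve_length a a' \<gamma>)"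
  have "curve_length a' b' \<gamma> < top" "curve_length a a' \<gamma> < top"
    using curve_length_mono[of a a' b' b \<gamma>] curve_length_mono[of a a a' b \<gamma>] sub fin
    by (auto intro: le_less_trans)
  then have L: "ennreal L = curve_length a b \<gamma>" "ennreal L' = curve_length a' b' \<gamma>"
    "ennreal L0 = curve_length a a' \<gamma>" and nonneg: "0 \<le> L" "0 \<le> L'" "0 \<le> L0"
    using fin by (simp_all add: L_def L'_def L0_def)
  have "ennreal (L0 + L') \<le> ennreal L"
  proof -
    have "ennreal (L0 + L') = curve_length a b' \<gamma>"
      using curve_length_add[of a a' b' \<gamma>] sub nonneg by (simp add: L ennreal_plus)
    also have "\<dots> \<le> ennreal L"
      using curve_length_mono[of a a b' b \<gamma>] sub by (simp add: L)
    finally show ?thesis .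
  qed
  then have LL: "L0 + L' \<le> L"
    using nonneg by (simp add: ennreal_le_iff del: ennreal_plus)
  let ?G = "\<lambda>s. g (arclength_param a b \<gamma> s) * indicator {0..L} s"
  have pt: "h (arclength_param a' b' \<gamma> s) \<le> g (arclength_param a b \<gamma> (L0 + s))"
    if s: "0 < s" "s < L'" for s
  proof -
    have "ennreal s \<le> curve_length a' b' \<gamma>"
      unfolding L(2)[symmetric] using s by (intro ennreal_leI) simp
    then obtain t where t: "t \<in> {a'..b'}" "curve_length a' t \<gamma> = ennreal s"
      using curve_length_attained[of a' b' \<gamma> s] continuous_on_subset[OF cont, of "{a'..b'}"]
        sub s \<open>curve_length a' b' \<gamma> < top\<close> by auto
    have "t \<noteq> a'" "t \<noteq> b'"
      using t(2) s L(2)[symmetric] nonneg by auto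
    have "curve_length a t \<gamma> = ennreal (L0 + s)"
      using curve_length_add[of a a' t \<gamma>] t sub nonneg s by (simp add: L ennreal_plus)
    then have "arclength_param a b \<gamma> (L0 + s) = \<gamma> t"
      using t sub by (intro arclength_param_eq) auto
    moreover have "arclength_param a' b' \<gamma> s = \<gamma> t"
      using t by (rule arclength_param_eq)
    moreover have "h (\<gamma> t) \<le> g (\<gamma> t)"
      using t \<open>t \<noteq> a'\<close> \<open>t \<noteq> b'\<close> by (intro le) auto
    ultimately show ?thesis by simp
  qed
  have "path_integral h (\<gamma>, a', b') = (\<integral>\<^sup>+s\<in>{0..L'}. h (arclength_param a' b' \<gamma> s) \<partial>lebesgue)"
    by (simp add: path_integral_def L'_def)
  also have "\<dots> \<le> (\<integral>\<^sup>+s. ?G (L0 + s) \<partial>lebesgue)"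
  proof (rule nn_integral_mono_AE)
    have "AE s in lebesgue. s \<noteq> x" for x :: real
      by (rule AE_completion) (rule AE_lborel_singleton)
    from this[of 0] this[of L']
    show "AE s in lebesgue. h (arclength_param a' b' \<gamma> s) * indicator {0..L'} s \<le> ?G (L0 + s)"
    proof eventually_elim
      case (elim s)
      then show ?case
        using pt[of s] LL nonneg by (auto split: split_indicator)
    qed
  qed
  also have "\<dots> \<le> (\<integral>\<^sup>+s. ?G s \<partial>lebesgue)"
    by (rule nn_integral_lebesgue_translate_le)
  also have "\<dots> = path_integral g (\<gamma>, a, b)"
    by (simp add: path_integral_def L_def)
  finally show ?thesis .
qed

section \<open>Powers of extended nonnegative numbers\<close>

lemma top_epowr [simp]: "top epowr p = top"
  by (simp add: enn_powr_def)

lemma epowr_ennreal: "0 \<le> r \<Longrightarrow> ennreal r epowr p = ennreal (r powr p)"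
  by (simp add: enn_powr_def)

lemma zero_epowr [simp]: "0 epowr p = 0"
  by (simp add: enn_powr_def)

lemma epowr_one [simp]: "x epowr 1 = x"
  by (cases x) (simp_all add: epowr_ennreal)

lemma epowr_less_top_iff: "x epowr p < top \<longleftrightarrow> x < top"
  by (simp add: enn_powr_def less_top)

lemma epowr_mono:
  assumes "0 \<le> p" "x \<le> y"
  shows "x epowr p \<le> y epowr p"
proof (cases "y = top")
  case False
  then have "x \<noteq> top"
    using assms by (auto simp: top_unique)
  with False show ?thesis
    using assms by (auto simp: enn_powr_def less_top intro!: ennreal_leI powr_mono2 enn2real_mono)
qed simp

lemma epowr_mult: "(x * y) epowr p = x epowr p * y epowr p"
proof (cases x; cases y)
  fix r s assume "x = ennreal r" "y = ennreal s" "0 \<le> r" "0 \<le> s"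
  then show ?thesis
    by (simp add: epowr_ennreal ennreal_mult[symmetric] powr_mult)
qed (auto simp: epowr_ennreal ennreal_mult_top ennreal_top_mult)

lemma epowr_epowr: "(x epowr a) epowr b = x epowr (a * b)"
  by (cases x) (simp_all add: epowr_ennreal powr_powr)

lemma epowr_add: "x epowr (a + b) = x epowr a * x epowr b"
  by (cases x) (simp_all add: epowr_ennreal powr_add ennreal_mult)

lemma measurable_epowr [measurable (raw)]:
  assumes [measurable]: "f \<in> borel_measurable M"
  shows "(\<lambda>x. f x epowr p) \<in> borel_measurable M"
  unfolding enn_powr_def by measurable

section \<open>The measure of a Borel regular outer measure\<close>

lemma caratheodory_measure_space:
  fixes \<mu> :: "'a::topological_space set \<Rightarrow> ennreal"
  assumes "borel_regular_outer_measure \<mu>"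
  shows "measure_space UNIV (lambda_system UNIV UNIV \<mu>) \<mu>"
proof -
  interpret sigma_algebra "UNIV :: 'a set" UNIV
    using sigma_algebra_Pow[of "UNIV :: 'a set"] by simp
  show ?thesis
    using assms unfolding borel_regular_outer_measure_def by (intro caratheodory_lemma) simp
qed

lemma space_caratheodory_measure [simp]: "space (caratheodory_measure \<mu>) = UNIV"
  by (simp add: caratheodory_measure_def space_measure_of_conv)

lemma sets_caratheodory_measure:
  assumes "borel_regular_outer_measure \<mu>"
  shows "sets (caratheodory_measure \<mu>) = lambda_system UNIV UNIV \<mu>"
proof -
  have "sigma_algebra UNIV (lambda_system UNIV UNIV \<mu>)"
    using caratheodory_measure_space[OF assms] by (simp add: measure_space_def)
  then show ?thesis
    by (simp add: caratheodory_measure_def sets_measure_of_conv sigma_algebra.sigma_sets_eq)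
qed

lemma borel_sets_caratheodory_measure:
  assumes "borel_regular_outer_measure \<mu>" "A \<in> sets borel"
  shows "A \<in> sets (caratheodory_measure \<mu>)"
  using assms by (auto simp: sets_caratheodory_measure borel_regular_outer_measure_def)

lemma emeasure_caratheodory_measure:
  assumes "borel_regular_outer_measure \<mu>" "A \<in> sets borel"
  shows "emeasure (caratheodory_measure \<mu>) A = \<mu> A"
  unfolding caratheodory_measure_def
proof (rule emeasure_measure_of_sigma)
  show "sigma_algebra UNIV (lambda_system UNIV UNIV \<mu>)" "positive (lambda_system UNIV UNIV \<mu>) \<mu>"
    "countably_additive (lambda_system UNIV UNIV \<mu>) \<mu>"
    using caratheodory_measure_space[OF assms(1)] by (simp_all add: measure_space_def)
  show "A \<in> lambda_system UNIV UNIV \<mu>"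
    using borel_sets_caratheodory_measure[OF assms] assms(1) by (simp add: sets_caratheodory_measure)
qed

lemma continuous_on_measurable_caratheodory:
  fixes f :: "'a::metric_space \<Rightarrow> 'b::topological_space"
  assumes \<mu>: "borel_regular_outer_measure \<mu>" and \<Omega>: "\<Omega> \<in> sets borel" and "continuous_on \<Omega> f"
  shows "f \<in> borel_measurable (restrict_space (caratheodory_measure \<mu>) \<Omega>)"
proof (rule measurableI)
  fix A :: "'b set" assume "A \<in> sets borel"
  then have "f -` A \<inter> \<Omega> \<in> sets (restrict_space borel \<Omega>)"
    using borel_measurable_continuous_on_restrict[OF assms(3)]
    by (auto simp: measurable_def space_restrict_space)
  then obtain B where "B \<in> sets borel" "f -` A \<inter> \<Omega> = B \<inter> \<Omega>"
    by (auto simp: sets_restrict_space)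
  then show "f -` A \<inter> space (restrict_space (caratheodory_measure \<mu>) \<Omega>)
      \<in> sets (restrict_space (caratheodory_measure \<mu>) \<Omega>)"
    using borel_sets_caratheodory_measure[OF \<mu>, of B]
    by (auto simp: sets_restrict_space space_restrict_space)
qed simp

section \<open>Weak upper gradients\<close>

lemma energy_mono:
  assumes "0 \<le> p" "\<And>x. x \<in> \<Omega> \<Longrightarrow> g x \<le> h x"
  shows "energy \<mu> p \<Omega> g \<le> energy \<mu> p \<Omega> h"
  unfolding energy_def
  by (intro nn_integral_mono) (use assms in \<open>auto split: split_indicator intro: epowr_mono\<close>)

lemma paths_in_subpath:
  assumes "(\<gamma>, a, b) \<in> paths_in \<Omega>" "a \<le> a'" "a' \<le> b'" "b' \<le> b" "\<gamma> a' \<noteq> \<gamma> b'"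
  shows "(\<gamma>, a', b') \<in> paths_in \<Omega>"
proof -
  have sub: "{a'..b'} \<subseteq> {a..b}"
    using assms by auto
  have "\<not> \<gamma> constant_on {a'..b'}"
    using assms(3,5) unfolding constant_on_def by force
  then show ?thesis
    using assms sub curve_length_mono[of a a' b' b \<gamma>] unfolding paths_in_def
    by (auto intro: continuous_on_subset le_less_trans)
qed

lemma paths_in_le: "(\<gamma>, a, b) \<in> paths_in \<Omega> \<Longrightarrow> a \<le> b"
  by (cases "a \<le> b") (auto simp: paths_in_def constant_on_def)

lemma upper_gradient_ineq_real [simp]:
  "upper_gradient_ineq (\<lambda>x. ereal (u x)) g (\<gamma>, a, b) \<longleftrightarrow>
     ennreal \<bar>u (\<gamma> a) - u (\<gamma> b)\<bar> \<le> path_integral g (\<gamma>, a, b)"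
  by (simp add: upper_gradient_ineq_def)

text \<open>The paths with a subpath in a family of zero modulus again form a family of zero modulus: the
  same density has infinite integral along them. Hence the upper gradient inequality for \<open>v\<close>
  along almost every path may be derived from that for \<open>u\<close> along all subpaths at once.\<close>

lemma weak_upper_gradient_subpathI:
  assumes g: "g \<in> weak_upper_gradients \<mu> p \<Omega> u"
    and h: "h \<in> borel_measurable (restrict_space (caratheodory_measure \<mu>) \<Omega>)"
    and ineq: "\<And>\<gamma> a b. (\<gamma>, a, b) \<in> paths_in \<Omega> \<Longrightarrow>
      (\<And>a' b'. a \<le> a' \<Longrightarrow> b' \<le> b \<Longrightarrow> (\<gamma>, a', b') \<in> paths_in \<Omega> \<Longrightarrow> upper_gradient_ineq u g (\<gamma>, a', b')) \<Longrightarrow>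
      upper_gradient_ineq v h (\<gamma>, a, b)"
  shows "h \<in> weak_upper_gradients \<mu> p \<Omega> v"
proof -
  obtain \<rho> where \<rho>: "\<rho> \<in> borel_measurable (restrict_space borel \<Omega>)"
    "(\<integral>\<^sup>+ x \<in> \<Omega>. \<rho> x epowr p \<partial>caratheodory_measure \<mu>) < top"
    "\<And>\<gamma>. \<gamma> \<in> paths_in \<Omega> \<Longrightarrow> \<not> upper_gradient_ineq u g \<gamma> \<Longrightarrow> path_integral \<rho> \<gamma> = top"
    using g unfolding weak_upper_gradients_def zero_modulus_def by blast
  have "path_integral \<rho> (\<gamma>, a, b) = top"
    if path: "(\<gamma>, a, b) \<in> paths_in \<Omega>" and fails: "\<not> upper_gradient_ineq v h (\<gamma>, a, b)" for \<gamma> a b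
  proof -
    obtain a' b' where ab: "a \<le> a'" "b' \<le> b" "(\<gamma>, a', b') \<in> paths_in \<Omega>"
      "\<not> upper_gradient_ineq u g (\<gamma>, a', b')"
      using ineq[OF path] fails by blast
    have "top = path_integral \<rho> (\<gamma>, a', b')"
      using \<rho>(3)[OF ab(3,4)] by simp
    also have "\<dots> \<le> path_integral \<rho> (\<gamma>, a, b)"
      using path ab paths_in_le[OF ab(3)]
      by (intro path_integral_subpath) (auto simp: paths_in_def)
    finally show ?thesis by (simp add: top_unique)
  qed
  then have "zero_modulus \<mu> p \<Omega> {\<gamma> \<in> paths_in \<Omega>. \<not> upper_gradient_ineq v h \<gamma>}"
    unfolding zero_modulus_def using \<rho>(1,2) by (intro exI[of _ \<rho>]) auto
  with h show ?thesis
    by (simp add: weak_upper_gradients_def)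
qed

lemma weak_upper_gradientI:
  assumes h: "h \<in> borel_measurable (restrict_space (caratheodory_measure \<mu>) \<Omega>)"
    and "\<And>\<gamma> a b. (\<gamma>, a, b) \<in> paths_in \<Omega> \<Longrightarrow> upper_gradient_ineq v h (\<gamma>, a, b)"
  shows "h \<in> weak_upper_gradients \<mu> p \<Omega> v"
  unfolding weak_upper_gradients_def zero_modulus_def
  using assms by (auto intro!: exI[of _ "\<lambda>_. 0"])

lemma weak_upper_gradient_measurable:
  "g \<in> weak_upper_gradients \<mu> p \<Omega> u \<Longrightarrow> g \<in> borel_measurable (restrict_space (caratheodory_measure \<mu>) \<Omega>)"
  by (simp add: weak_upper_gradients_def)

lemma weak_upper_gradient_contraction:
  assumes g: "g \<in> weak_upper_gradients \<mu> p \<Omega> (\<lambda>x. ereal (u x))"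
    and contr: "\<And>x y. \<bar>v x - v y\<bar> \<le> \<bar>u x - u y\<bar>"
  shows "g \<in> weak_upper_gradients \<mu> p \<Omega> (\<lambda>x. ereal (v x))"
proof (rule weak_upper_gradient_subpathI[OF g weak_upper_gradient_measurable[OF g]])
  fix \<gamma> a b
  assume path: "(\<gamma>, a, b) \<in> paths_in \<Omega>" and
    sub: "\<And>a' b'. a \<le> a' \<Longrightarrow> b' \<le> b \<Longrightarrow> (\<gamma>, a', b') \<in> paths_in \<Omega> \<Longrightarrow>
      upper_gradient_ineq (\<lambda>x. ereal (u x)) g (\<gamma>, a', b')"
  have "ennreal \<bar>v (\<gamma> a) - v (\<gamma> b)\<bar> \<le> ennreal \<bar>u (\<gamma> a) - u (\<gamma> b)\<bar>"
    by (intro ennreal_leI contr)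
  also have "\<dots> \<le> path_integral g (\<gamma>, a, b)"
    using sub[of a b] path by simp
  finally show "upper_gradient_ineq (\<lambda>x. ereal (v x)) g (\<gamma>, a, b)"
    by simp
qed

lemma weak_upper_gradient_cmult:
  assumes g: "g \<in> weak_upper_gradients \<mu> p \<Omega> (\<lambda>x. ereal (u x))" and "0 \<le> c"
  shows "(\<lambda>x. ennreal c * g x) \<in> weak_upper_gradients \<mu> p \<Omega> (\<lambda>x. ereal (c * u x))"
proof (rule weak_upper_gradient_subpathI[OF g])
  show "(\<lambda>x. ennreal c * g x) \<in> borel_measurable (restrict_space (caratheodory_measure \<mu>) \<Omega>)"
    using weak_upper_gradient_measurable[OF g] by simp
next
  fix \<gamma> a b
  assume path: "(\<gamma>, a, b) \<in> paths_in \<Omega>" and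
    sub: "\<And>a' b'. a \<le> a' \<Longrightarrow> b' \<le> b \<Longrightarrow> (\<gamma>, a', b') \<in> paths_in \<Omega> \<Longrightarrow>
      upper_gradient_ineq (\<lambda>x. ereal (u x)) g (\<gamma>, a', b')"
  have "ennreal \<bar>c * u (\<gamma> a) - c * u (\<gamma> b)\<bar> = ennreal c * ennreal \<bar>u (\<gamma> a) - u (\<gamma> b)\<bar>"
    using \<open>0 \<le> c\<close> by (simp add: ennreal_mult[symmetric] abs_mult right_diff_distrib[symmetric])
  also have "\<dots> \<le> ennreal c * path_integral g (\<gamma>, a, b)"
    using sub[of a b] path by (intro mult_left_mono) auto
  also have "\<dots> \<le> path_integral (\<lambda>x. ennreal c * g x) (\<gamma>, a, b)"
    by (rule path_integral_cmult_ge)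
  finally show "upper_gradient_ineq (\<lambda>x. ereal (c * u x)) (\<lambda>x. ennreal c * g x) (\<gamma>, a, b)"
    by simp
qed

lemma crossing_interval:
  fixes w :: "real \<Rightarrow> real"
  assumes cont: "continuous_on {a..b} w" and ab: "a \<le> b" "w a \<le> \<alpha>" "\<alpha> < \<beta>" "\<beta> \<le> w b"
  obtains a' b' where "a \<le> a'" "a' < b'" "b' \<le> b" "w a' \<le> \<alpha>" "\<beta> \<le> w b'"
    "\<And>t. a' < t \<Longrightarrow> t < b' \<Longrightarrow> \<alpha> < w t \<and> w t < \<beta>"
proof -
  \<comment> \<open>\<open>a'\<close> is the last parameter with value at most \<open>\<alpha>\<close>, and \<open>b'\<close> the first one after it with value
    at least \<open>\<beta>\<close>.\<close>
  let ?A = "{t \<in> {a..b}. w t \<le> \<alpha>}"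
  have "closed ?A"
    by (intro continuous_on_closed_Collect_le cont continuous_on_const) simp
  moreover have "bounded ?A"
    by (rule bounded_subset[OF bounded_closed_interval[of a b]]) auto
  ultimately have "compact ?A"
    by (simp add: compact_eq_bounded_closed)
  then obtain a' where a': "a' \<in> ?A" "\<And>t. t \<in> ?A \<Longrightarrow> t \<le> a'"
    using compact_attains_sup[of ?A] ab by fastforce
  let ?B = "{t \<in> {a'..b}. \<beta> \<le> w t}"
  have "closed ?B"
    by (intro continuous_on_closed_Collect_le continuous_on_const continuous_on_subset[OF cont])
      (use a' in auto)
  moreover have "bounded ?B"
    by (rule bounded_subset[OF bounded_closed_interval[of a' b]]) auto
  ultimately have "compact ?B"
    by (simp add: compact_eq_bounded_closed)
  then obtain b' where b': "b' \<in> ?B" "\<And>t. t \<in> ?B \<Longrightarrow> b' \<le> t"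
    using compact_attains_inf[of ?B] ab a' by fastforce
  show ?thesis
  proof (rule that[of a' b'])
    show "a' < b'"
      using a'(1) b'(1) ab by (cases "a' = b'") auto
    show "\<alpha> < w t \<and> w t < \<beta>" if "a' < t" "t < b'" for t
    proof -
      have "t \<in> {a..b}" "t \<in> {a'..b}"
        using a'(1) b'(1) that by auto
      moreover have "t \<notin> ?A" "t \<notin> ?B"
        using a'(2)[of t] b'(2)[of t] that by linarith+
      ultimately show ?thesis by auto
    qed
  qed (use a' b' in auto)
qed

text \<open>Truncating \<open>u\<close> to \<open>[r, s]\<close> localises a weak upper gradient to the set where \<open>r < u < s\<close>. If
  the truncations at the endpoints of a path differ, being \<open>\<alpha> < \<beta>\<close> say, then \<open>u\<close> crosses from
  \<open>\<alpha>\<close> to \<open>\<beta>\<close> on a subpath inside which \<open>\<alpha> < u < \<beta>\<close>, and the inequality for \<open>u\<close> along this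
  subpath is enough.\<close>

lemma weak_upper_gradient_truncate:
  assumes g: "g \<in> weak_upper_gradients \<mu> p \<Omega> (\<lambda>x. ereal (u x))"
    and \<mu>: "borel_regular_outer_measure \<mu>" and \<Omega>: "open \<Omega>"
    and cont: "continuous_on \<Omega> u" and "r < s"
  shows "(\<lambda>x. g x * indicator {x. r < u x \<and> u x < s} x)
    \<in> weak_upper_gradients \<mu> p \<Omega> (\<lambda>x. ereal (max r (min s (u x))))"
    (is "?h \<in> weak_upper_gradients \<mu> p \<Omega> (\<lambda>x. ereal (?v x))")
proof (rule weak_upper_gradient_subpathI[OF g])
  have [measurable]: "u \<in> borel_measurable (restrict_space (caratheodory_measure \<mu>) \<Omega>)"
    using \<mu> \<Omega> cont by (intro continuous_on_measurable_caratheodory) auto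
  have [measurable]: "g \<in> borel_measurable (restrict_space (caratheodory_measure \<mu>) \<Omega>)"
    using g by (rule weak_upper_gradient_measurable)
  have "(\<lambda>x. if r < u x \<and> u x < s then g x else 0)
      \<in> borel_measurable (restrict_space (caratheodory_measure \<mu>) \<Omega>)"
    by measurable
  then show "?h \<in> borel_measurable (restrict_space (caratheodory_measure \<mu>) \<Omega>)"
    by (rule measurable_cong[THEN iffD1, rotated]) auto
next
  fix \<gamma> a b
  assume path: "(\<gamma>, a, b) \<in> paths_in \<Omega>" and
    sub: "\<And>a' b'. a \<le> a' \<Longrightarrow> b' \<le> b \<Longrightarrow> (\<gamma>, a', b') \<in> paths_in \<Omega> \<Longrightarrow>
      upper_gradient_ineq (\<lambda>x. ereal (u x)) g (\<gamma>, a', b')"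
  have \<gamma>: "continuous_on {a..b} \<gamma>" "curve_length a b \<gamma> < top" "\<gamma> ` {a..b} \<subseteq> \<Omega>"
    using path by (auto simp: paths_in_def)
  have ab: "a \<le> b"
    using path by (rule paths_in_le)
  have w: "continuous_on {a..b} (\<lambda>t. u (\<gamma> t))"
    using continuous_on_compose2[OF cont \<gamma>(1)] \<gamma>(3) by blast
  have main: "ennreal (\<beta> - \<alpha>) \<le> path_integral ?h (\<gamma>, a, b)"
    if "a \<le> a'" "a' < b'" "b' \<le> b" and diff: "\<beta> - \<alpha> \<le> \<bar>u (\<gamma> a') - u (\<gamma> b')\<bar>" and "\<alpha> < \<beta>"
      and btw: "\<And>t. a' < t \<Longrightarrow> t < b' \<Longrightarrow> r < u (\<gamma> t) \<and> u (\<gamma> t) < s" for a' b' \<alpha> \<beta>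
  proof -
    have "(\<gamma>, a', b') \<in> paths_in \<Omega>"
      using that by (intro paths_in_subpath[OF path]) auto
    then have "ennreal \<bar>u (\<gamma> a') - u (\<gamma> b')\<bar> \<le> path_integral g (\<gamma>, a', b')"
      using sub[of a' b'] that by simp
    also have "\<dots> \<le> path_integral ?h (\<gamma>, a, b)"
      using that by (intro path_integral_subpath \<gamma>) auto
    finally show ?thesis
      using ennreal_leI[OF diff] by (rule order_trans[rotated])
  qed
  define \<alpha> \<beta> where "\<alpha> = ?v (\<gamma> a)" and "\<beta> = ?v (\<gamma> b)"
  have range: "r \<le> \<alpha>" "r \<le> \<beta>" "\<alpha> \<le> s" "\<beta> \<le> s"
    using \<open>r < s\<close> by (auto simp: \<alpha>_def \<beta>_def)
  have "ennreal \<bar>\<alpha> - \<beta>\<bar> \<le> path_integral ?h (\<gamma>, a, b)"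
  proof (cases \<alpha> \<beta> rule: linorder_cases)
    case less
    then have "u (\<gamma> a) \<le> \<alpha>" "\<beta> \<le> u (\<gamma> b)"
      by (auto simp: \<alpha>_def \<beta>_def max_def min_def split: if_splits)
    then obtain a' b' where c: "a \<le> a'" "a' < b'" "b' \<le> b" "u (\<gamma> a') \<le> \<alpha>" "\<beta> \<le> u (\<gamma> b')"
      and btw: "\<And>t. a' < t \<Longrightarrow> t < b' \<Longrightarrow> \<alpha> < u (\<gamma> t) \<and> u (\<gamma> t) < \<beta>"
      using crossing_interval[OF w ab _ less] by blast
    have "r < u (\<gamma> t) \<and> u (\<gamma> t) < s" if "a' < t" "t < b'" for t
      using btw[OF that] range by linarith
    moreover have "\<beta> - \<alpha> \<le> \<bar>u (\<gamma> a') - u (\<gamma> b')\<bar>"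
      using c less by linarith
    ultimately have "ennreal (\<beta> - \<alpha>) \<le> path_integral ?h (\<gamma>, a, b)"
      using c less by (intro main)
    then show ?thesis
      using less by simp
  next
    case greater
    \<comment> \<open>A descent of \<open>u\<close> is an ascent of \<open>- u\<close>.\<close>
    then have "- u (\<gamma> a) \<le> - \<alpha>" "- \<beta> \<le> - u (\<gamma> b)" "- \<alpha> < - \<beta>"
      by (auto simp: \<alpha>_def \<beta>_def max_def min_def split: if_splits)
    then obtain a' b' where c: "a \<le> a'" "a' < b'" "b' \<le> b" "- u (\<gamma> a') \<le> - \<alpha>" "- \<beta> \<le> - u (\<gamma> b')"
      and btw: "\<And>t. a' < t \<Longrightarrow> t < b' \<Longrightarrow> - \<alpha> < - u (\<gamma> t) \<and> - u (\<gamma> t) < - \<beta>"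
      using crossing_interval[OF continuous_on_minus[OF w] ab, of "- \<alpha>" "- \<beta>"] by blast
    have "r < u (\<gamma> t) \<and> u (\<gamma> t) < s" if "a' < t" "t < b'" for t
      using btw[OF that] range by linarith
    moreover have "\<alpha> - \<beta> \<le> \<bar>u (\<gamma> a') - u (\<gamma> b')\<bar>"
      using c greater by linarith
    ultimately have "ennreal (\<alpha> - \<beta>) \<le> path_integral ?h (\<gamma>, a, b)"
      using c greater by (intro main)
    then show ?thesis
      using greater by simp
  qed simp
  then show "upper_gradient_ineq (\<lambda>x. ereal (?v x)) ?h (\<gamma>, a, b)"
    by (simp only: upper_gradient_ineq_real \<alpha>_def \<beta>_def)
qed

section \<open>Continuous Newtonian functions\<close>

lemma N1p_cont_iff:
  assumes "borel_regular_outer_measure \<mu>" "open \<Omega>"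
  shows "u \<in> N1p_cont \<mu> p \<Omega> \<longleftrightarrow> continuous_on \<Omega> u \<and> energy \<mu> p \<Omega> (\<lambda>x. ennreal \<bar>u x\<bar>) < top \<and>
    (\<exists>g \<in> weak_upper_gradients \<mu> p \<Omega> (\<lambda>x. ereal (u x)). energy \<mu> p \<Omega> g < top)"
proof -
  have "(\<lambda>x. ereal (u x)) \<in> borel_measurable (restrict_space (caratheodory_measure \<mu>) \<Omega>)"
    if "continuous_on \<Omega> u"
    using continuous_on_measurable_caratheodory[OF assms(1) _ that] assms(2) by simp
  then show ?thesis
    by (auto simp: N1p_cont_def N1p_def N1p_norm_def epowr_less_top_iff INF_less_iff)
qed

section \<open>Estimates by level sets\<close>

lemma energy_restrict_space:
  assumes "borel_regular_outer_measure \<mu>" "open \<Omega>"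
  shows "energy \<mu> p \<Omega> f = (\<integral>\<^sup>+x. f x epowr p \<partial>restrict_space (caratheodory_measure \<mu>) \<Omega>)"
  unfolding energy_def
  by (subst nn_integral_restrict_space) (use borel_sets_caratheodory_measure[OF assms(1), of \<Omega>] assms(2) in auto)

lemma energy_cmult:
  assumes "borel_regular_outer_measure \<mu>" "open \<Omega>"
    and [measurable]: "f \<in> borel_measurable (restrict_space (caratheodory_measure \<mu>) \<Omega>)"
  shows "energy \<mu> p \<Omega> (\<lambda>x. c * f x) = c epowr p * energy \<mu> p \<Omega> f"
  unfolding energy_restrict_space[OF assms(1,2)] epowr_mult
  by (rule nn_integral_cmult) measurable

lemma closedin_superlevel_set:
  fixes u :: "'a::metric_space \<Rightarrow> real"
  assumes "continuous_on \<Omega> u"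
  shows "closedin (top_of_set \<Omega>) {x \<in> \<Omega>. s \<le> \<bar>u x\<bar>}"
proof -
  have "closedin (top_of_set \<Omega>) (\<Omega> \<inter> (\<lambda>x. \<bar>u x\<bar>) -` {s..})"
    using assms by (intro continuous_closedin_preimage continuous_intros) auto
  moreover have "\<Omega> \<inter> (\<lambda>x. \<bar>u x\<bar>) -` {s..} = {x \<in> \<Omega>. s \<le> \<bar>u x\<bar>}"
    by auto
  ultimately show ?thesis by simp
qed

lemma closedin_open_borel:
  assumes "open \<Omega>" "closedin (top_of_set \<Omega>) F"
  shows "F \<in> sets borel"
  using assms by (auto simp: closedin_closed)

text \<open>The competitor is the truncation of \<open>\<bar>u\<bar>\<close> to \<open>[r, s]\<close>, normalised to take the values 0 and 1 at
  the two levels. It is at most \<open>\<bar>u\<bar> / (s - r)\<close>, hence again \<open>p\<close>-integrable.\<close>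

lemma conductivity_level_set:
  assumes \<mu>: "borel_regular_outer_measure \<mu>" and \<Omega>: "open \<Omega>" and p: "0 \<le> p"
    and u: "u \<in> N1p_cont \<mu> p \<Omega>" "\<And>x. x \<in> \<Omega> - G \<Longrightarrow> u x = 0"
    and g: "g \<in> weak_upper_gradients \<mu> p \<Omega> (\<lambda>x. ereal (u x))" "energy \<mu> p \<Omega> g < top"
    and rs: "0 \<le> r" "r < s"
  shows "conductivity \<mu> p {x \<in> \<Omega>. s \<le> \<bar>u x\<bar>} G \<Omega> \<le>
    ennreal (1 / (s - r)) epowr p * energy \<mu> p \<Omega> (\<lambda>x. g x * indicator {x. r < \<bar>u x\<bar> \<and> \<bar>u x\<bar> < s} x)"
proof -
  let ?c = "1 / (s - r)"
  let ?E = "{x. r < \<bar>u x\<bar> \<and> \<bar>u x\<bar> < s}"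
  define v where "v x = ?c * (max r (min s \<bar>u x\<bar>) - r)" for x
  define h where "h x = ennreal ?c * (g x * indicator ?E x)" for x
  have c: "0 < ?c"
    using rs by simp
  have cont: "continuous_on \<Omega> u" and Lp: "energy \<mu> p \<Omega> (\<lambda>x. ennreal \<bar>u x\<bar>) < top"
    using u(1) N1p_cont_iff[OF \<mu> \<Omega>] by auto
  have "g \<in> weak_upper_gradients \<mu> p \<Omega> (\<lambda>x. ereal \<bar>u x\<bar>)"
    by (rule weak_upper_gradient_contraction[OF g(1)]) simp
  then have trunc: "(\<lambda>x. g x * indicator ?E x)
      \<in> weak_upper_gradients \<mu> p \<Omega> (\<lambda>x. ereal (max r (min s \<bar>u x\<bar>)))"
    using cont rs by (intro weak_upper_gradient_truncate[OF _ \<mu> \<Omega>] continuous_intros) auto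
  then have "(\<lambda>x. g x * indicator ?E x)
      \<in> weak_upper_gradients \<mu> p \<Omega> (\<lambda>x. ereal (max r (min s \<bar>u x\<bar>) - r))"
    by (rule weak_upper_gradient_contraction) simp
  then have h: "h \<in> weak_upper_gradients \<mu> p \<Omega> (\<lambda>x. ereal (v x))"
    unfolding h_def[abs_def] v_def[abs_def] using c by (intro weak_upper_gradient_cmult) auto
  have "energy \<mu> p \<Omega> h
      = ennreal ?c epowr p * energy \<mu> p \<Omega> (\<lambda>x. g x * indicator ?E x)"
    unfolding h_def[abs_def]
    by (rule energy_cmult[OF \<mu> \<Omega> weak_upper_gradient_measurable[OF trunc]])
  moreover have "energy \<mu> p \<Omega> (\<lambda>x. g x * indicator ?E x) \<le> energy \<mu> p \<Omega> g"
    by (rule energy_mono[OF p]) (simp split: split_indicator)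
  ultimately have h_fin: "energy \<mu> p \<Omega> h < top"
    using g(2) by (auto simp: ennreal_mult_less_top epowr_less_top_iff)
  have "v \<in> N1p_cont \<mu> p \<Omega>"
    unfolding N1p_cont_iff[OF \<mu> \<Omega>]
  proof (intro conjI)
    show "\<exists>g\<in>weak_upper_gradients \<mu> p \<Omega> (\<lambda>x. ereal (v x)). energy \<mu> p \<Omega> g < top"
      using h h_fin by blast
    show "continuous_on \<Omega> v"
      unfolding v_def[abs_def] by (intro continuous_intros cont)
    have le: "ennreal \<bar>v x\<bar> \<le> ennreal ?c * ennreal \<bar>u x\<bar>" for x
    proof -
      have "\<bar>max r (min s \<bar>u x\<bar>) - r\<bar> \<le> \<bar>u x\<bar>"
        using rs by (auto simp: max_def min_def)
      then have "\<bar>v x\<bar> \<le> ?c * \<bar>u x\<bar>"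
        unfolding v_def abs_mult using c by (simp add: divide_right_mono)
      then show ?thesis
        using c by (simp add: ennreal_mult[symmetric] ennreal_leI)
    qed
    have [measurable]: "u \<in> borel_measurable (restrict_space (caratheodory_measure \<mu>) \<Omega>)"
      using \<mu> \<Omega> cont by (intro continuous_on_measurable_caratheodory) auto
    have "energy \<mu> p \<Omega> (\<lambda>x. ennreal ?c * ennreal \<bar>u x\<bar>)
        = ennreal ?c epowr p * energy \<mu> p \<Omega> (\<lambda>x. ennreal \<bar>u x\<bar>)"
      by (rule energy_cmult[OF \<mu> \<Omega>]) measurable
    also have "\<dots> < top"
      using Lp by (simp only: ennreal_mult_less_top epowr_less_top_iff ennreal_less_top) blast
    finally have "energy \<mu> p \<Omega> (\<lambda>x. ennreal ?c * ennreal \<bar>u x\<bar>) < top" .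
    then show "energy \<mu> p \<Omega> (\<lambda>x. ennreal \<bar>v x\<bar>) < top"
      by (rule le_less_trans[OF energy_mono[OF p le]])
  qed
  moreover have "v x = 1" if "s \<le> \<bar>u x\<bar>" for x
    using that rs by (simp add: v_def max_def)
  moreover have "v x = 0" if "x \<in> \<Omega> - G" for x
    using u(2)[OF that] rs by (simp add: v_def max_def)
  ultimately have "v \<in> admissible \<mu> p {x \<in> \<Omega>. s \<le> \<bar>u x\<bar>} G \<Omega>"
    by (simp add: admissible_def)
  then have "conductivity \<mu> p {x \<in> \<Omega>. s \<le> \<bar>u x\<bar>} G \<Omega> \<le> energy \<mu> p \<Omega> h"
    unfolding conductivity_def using h by (intro INF_lower2[of v] INF_lower)
  also have "\<dots> = ennreal ?c epowr p * energy \<mu> p \<Omega> (\<lambda>x. g x * indicator ?E x)"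
    by fact
  finally show ?thesis .
qed

text \<open>The layers are disjoint: a point \<open>x\<close> can only lie in the one with \<open>k = \<lceil>log 2 \<bar>u x\<bar>\<rceil>\<close>.\<close>

lemma level_sets_energy_sum_le:
  fixes u :: "'a::metric_space \<Rightarrow> real"
  assumes \<mu>: "borel_regular_outer_measure \<mu>" and \<Omega>: "open \<Omega>" and cont: "continuous_on \<Omega> u"
    and g: "g \<in> borel_measurable (restrict_space (caratheodory_measure \<mu>) \<Omega>)"
  shows "(\<integral>\<^sup>+k. energy \<mu> p \<Omega>
      (\<lambda>x. g x * indicator {x. 2 powr (of_int k - 1) < \<bar>u x\<bar> \<and> \<bar>u x\<bar> < 2 powr of_int k} x) \<partial>count_space (UNIV :: int set))
    \<le> energy \<mu> p \<Omega> g"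
proof -
  let ?E = "\<lambda>k::int. {x. 2 powr (of_int k - 1) < \<bar>u x\<bar> \<and> \<bar>u x\<bar> < 2 powr of_int k}"
  let ?M = "restrict_space (caratheodory_measure \<mu>) \<Omega>"
  note [measurable] = g
  have [measurable]: "u \<in> borel_measurable ?M"
    using \<mu> \<Omega> cont by (intro continuous_on_measurable_caratheodory) auto
  have meas: "(\<lambda>x. (g x * indicator (?E k) x) epowr p) \<in> borel_measurable ?M" for k
  proof -
    have "(\<lambda>x. (if 2 powr (of_int k - 1) < \<bar>u x\<bar> \<and> \<bar>u x\<bar> < 2 powr of_int k then g x else 0) epowr p)
        \<in> borel_measurable ?M"
      by measurable
    also have "(\<lambda>x. (if 2 powr (of_int k - 1) < \<bar>u x\<bar> \<and> \<bar>u x\<bar> < 2 powr of_int k then g x else 0) epowr p)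
        = (\<lambda>x. (g x * indicator (?E k) x) epowr p)"
      by (intro ext) (simp split: split_indicator)
    finally show ?thesis .
  qed
  have "(\<integral>\<^sup>+k. energy \<mu> p \<Omega> (\<lambda>x. g x * indicator (?E k) x) \<partial>count_space UNIV)
      = (\<integral>\<^sup>+x. \<integral>\<^sup>+k. (g x * indicator (?E k) x) epowr p \<partial>count_space UNIV \<partial>?M)"
    unfolding energy_restrict_space[OF \<mu> \<Omega>]
    by (rule nn_integral_count_space_nn_integral[symmetric]) (use meas in auto)
  also have "\<dots> \<le> (\<integral>\<^sup>+x. g x epowr p \<partial>?M)"
  proof (rule nn_integral_mono)
    fix x
    let ?k = "\<lceil>log 2 \<bar>u x\<bar>\<rceil>"
    have single: "k = ?k" if "x \<in> ?E k" for k
    proof -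
      have y: "2 powr (of_int k - 1) < \<bar>u x\<bar>" "\<bar>u x\<bar> < 2 powr of_int k"
        using that by simp_all
      have "0 < \<bar>u x\<bar>"
        using y(1) by (rule less_trans[rotated]) simp
      then have "of_int k - 1 < log 2 \<bar>u x\<bar>" "log 2 \<bar>u x\<bar> < of_int k"
        using y by (simp_all only: less_log_iff[of 2] log_less_iff[of 2] one_less_numeral_iff semiring_norm)
      then show ?thesis
        by (intro ceiling_unique[symmetric]) linarith+
    qed
    have "(\<integral>\<^sup>+k. (g x * indicator (?E k) x) epowr p \<partial>count_space UNIV)
        \<le> (\<integral>\<^sup>+k. g x epowr p * indicator {?k} k \<partial>count_space UNIV)"
    proof (rule nn_integral_mono)
      fix k
      show "(g x * indicator (?E k) x) epowr p \<le> g x epowr p * indicator {?k} k"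
      proof (cases "x \<in> ?E k")
        case True
        then have "k \<in> {?k}"
          using single by blast
        with True show ?thesis
          by (simp only: indicator_simps mult_1_right order_refl)
      next
        case False
        then show ?thesis
          by (simp only: indicator_simps not_False_eq_True mult_zero_right zero_epowr zero_le)
      qed
    qed
    also have "\<dots> = g x epowr p"
      by (subst nn_integral_cmult_indicator) simp_all
    finally show "(\<integral>\<^sup>+k. (g x * indicator (?E k) x) epowr p \<partial>count_space UNIV) \<le> g x epowr p" .
  qed
  finally show ?thesis
    unfolding energy_restrict_space[OF \<mu> \<Omega>] .
qed

text \<open>A value with \<open>2 powr k \<le> \<bar>u x\<bar> < 2 powr (k + 1)\<close> is paid for by the single term of index \<open>k\<close>; this
  loses only a factor depending on \<open>q\<close>.\<close>

lemma nn_integral_dyadic_le: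
  fixes u :: "'a::metric_space \<Rightarrow> real"
  assumes \<nu>: "borel_regular_outer_measure \<nu>" and \<Omega>: "open \<Omega>" and cont: "continuous_on \<Omega> u"
    and q: "0 \<le> q"
  shows "(\<integral>\<^sup>+x\<in>\<Omega>. ennreal \<bar>u x\<bar> epowr q \<partial>caratheodory_measure \<nu>)
    \<le> (\<integral>\<^sup>+k. ennreal (2 powr ((of_int k + 1) * q)) * \<nu> {x \<in> \<Omega>. 2 powr of_int k \<le> \<bar>u x\<bar>} \<partial>count_space (UNIV :: int set))"
proof -
  let ?F = "\<lambda>k::int. {x \<in> \<Omega>. 2 powr of_int k \<le> \<bar>u x\<bar>}"
  let ?M = "caratheodory_measure \<nu>"
  have F: "?F k \<in> sets borel" for k
    using closedin_open_borel[OF \<Omega> closedin_superlevel_set[OF cont]] .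
  have FM [measurable]: "?F k \<in> sets ?M" for k
    using borel_sets_caratheodory_measure[OF \<nu> F] .
  have "(\<integral>\<^sup>+x\<in>\<Omega>. ennreal \<bar>u x\<bar> epowr q \<partial>?M)
      \<le> (\<integral>\<^sup>+x. \<integral>\<^sup>+k. ennreal (2 powr ((of_int k + 1) * q)) * indicator (?F k) x \<partial>count_space UNIV \<partial>?M)"
  proof (rule nn_integral_mono)
    fix x
    let ?f = "\<lambda>k. ennreal (2 powr ((of_int k + 1) * q)) * indicator (?F k) x"
    show "ennreal \<bar>u x\<bar> epowr q * indicator \<Omega> x \<le> (\<integral>\<^sup>+k. ?f k \<partial>count_space UNIV)"
    proof (cases "x \<in> \<Omega> \<and> u x \<noteq> 0")
      case True
      define k where "k = \<lfloor>log 2 \<bar>u x\<bar>\<rfloor>"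
      have "of_int k \<le> log 2 \<bar>u x\<bar>" "log 2 \<bar>u x\<bar> < of_int k + 1"
        by (simp_all add: k_def)
      then have k: "2 powr of_int k \<le> \<bar>u x\<bar>" "\<bar>u x\<bar> < 2 powr (of_int k + 1)"
        using True by (simp_all add: le_log_iff log_less_iff)
      have "ennreal \<bar>u x\<bar> epowr q = ennreal (\<bar>u x\<bar> powr q)"
        by (simp add: epowr_ennreal)
      also have "\<dots> \<le> ennreal ((2 powr (of_int k + 1)) powr q)"
        using k(2) q by (intro ennreal_leI powr_mono2) auto
      also have "\<dots> = ?f k"
        using True k(1) by (simp add: powr_powr)
      also have "\<dots> \<le> (\<integral>\<^sup>+k. ?f k \<partial>count_space UNIV)"
        by (rule nn_integral_ge_point) simp
      finally show ?thesis
        using True by simp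
    qed (auto split: split_indicator)
  qed
  also have "\<dots> = (\<integral>\<^sup>+k. \<integral>\<^sup>+x. ennreal (2 powr ((of_int k + 1) * q)) * indicator (?F k) x \<partial>?M \<partial>count_space UNIV)"
    by (rule nn_integral_count_space_nn_integral) auto
  also have "\<dots> = (\<integral>\<^sup>+k. ennreal (2 powr ((of_int k + 1) * q)) * \<nu> (?F k) \<partial>count_space UNIV)"
    by (simp only: nn_integral_cmult_indicator[OF FM] emeasure_caratheodory_measure[OF \<nu> F])
  finally show ?thesis .
qed

text \<open>Each term \<open>a k\<close> is at most the sum \<open>S\<close>, so \<open>a k epowr r \<le> a k * S epowr (r - 1)\<close>.\<close>

lemma nn_integral_count_space_epowr_le:
  assumes "1 \<le> r"
  shows "(\<integral>\<^sup>+k. a k epowr r \<partial>count_space A) \<le> (\<integral>\<^sup>+k. a k \<partial>count_space A) epowr r"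
proof -
  let ?S = "\<integral>\<^sup>+k. a k \<partial>count_space A"
  have split: "x epowr r = x * x epowr (r - 1)" for x
    using epowr_add[of x 1 "r - 1"] by simp
  have "(\<integral>\<^sup>+k. a k epowr r \<partial>count_space A) \<le> (\<integral>\<^sup>+k. a k * ?S epowr (r - 1) \<partial>count_space A)"
    unfolding split
    by (intro nn_integral_mono mult_left_mono epowr_mono)
      (use assms nn_integral_ge_point in auto)
  also have "\<dots> = ?S * ?S epowr (r - 1)"
    by (rule nn_integral_multc) simp
  finally show ?thesis
    unfolding split[of ?S] .
qed

section \<open>The two implications\<close>

text \<open>The factor 4 is the ratio of \<open>2 powr (k + 1)\<close>, the bound for \<open>\<bar>u\<bar>\<close> next to level \<open>k\<close>, and the width
  \<open>2 powr (k - 1)\<close> of the layer below that level. If \<open>g\<close> has infinite energy, the right-hand side is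
  infinite because \<open>C\<close> is positive.\<close>

lemma capacitary_strong_type_inequality:
  fixes \<mu> \<nu> :: "'a::metric_space set \<Rightarrow> ennreal"
  assumes \<mu>: "borel_regular_outer_measure \<mu>" and \<nu>: "borel_regular_outer_measure \<nu>"
    and \<Omega>: "open \<Omega>" and pq: "0 < p" "p \<le> q" and C: "0 < C"
    and iso: "\<And>F. closedin (top_of_set \<Omega>) F \<Longrightarrow> F \<subseteq> G \<Longrightarrow>
      \<nu> F epowr (p / q) \<le> ennreal C * conductivity \<mu> p F G \<Omega>"
    and u: "u \<in> N1p_cont \<mu> p \<Omega>" "\<And>x. x \<in> \<Omega> - G \<Longrightarrow> u x = 0"
    and g: "g \<in> weak_upper_gradients \<mu> p \<Omega> (\<lambda>x. ereal (u x))"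
  shows "(\<integral>\<^sup>+ x \<in> \<Omega>. ennreal \<bar>u x\<bar> epowr q \<partial>caratheodory_measure \<nu>) epowr (1 / q)
    \<le> ennreal (4 * C powr (1 / p)) * energy \<mu> p \<Omega> g epowr (1 / p)"
proof (cases "energy \<mu> p \<Omega> g < top")
  case False
  then have "energy \<mu> p \<Omega> g = top"
    by (simp add: less_top[symmetric])
  then show ?thesis
    using C by (simp add: ennreal_mult_top)
next
  case fin: True
  define S where "S = energy \<mu> p \<Omega> g"
  have q: "0 < q" using pq by simp
  have cont: "continuous_on \<Omega> u"
    using u(1) N1p_cont_iff[OF \<mu> \<Omega>] by auto
  define F where "F k = {x \<in> \<Omega>. 2 powr of_int k \<le> \<bar>u x\<bar>}" for k :: int
  define a where "a k = energy \<mu> p \<Omega>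
    (\<lambda>x. g x * indicator {x. 2 powr (of_int k - 1) < \<bar>u x\<bar> \<and> \<bar>u x\<bar> < 2 powr of_int k} x)" for k :: int
  have level: "\<nu> (F k) epowr (p / q) \<le> ennreal C * (ennreal (2 powr (1 - of_int k)) epowr p * a k)" for k
  proof -
    have "F k \<subseteq> G"
    proof
      fix x assume "x \<in> F k"
      then have "x \<in> \<Omega>" "u x \<noteq> 0"
        by (auto simp: F_def)
      then show "x \<in> G" using u(2)[of x] by blast
    qed
    then have "\<nu> (F k) epowr (p / q) \<le> ennreal C * conductivity \<mu> p (F k) G \<Omega>"
      unfolding F_def by (intro iso closedin_superlevel_set cont)
    also have "\<dots> \<le> ennreal C * (ennreal (1 / (2 powr of_int k - 2 powr (of_int k - 1))) epowr p * a k)"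
      unfolding F_def a_def
      using pq by (intro mult_left_mono conductivity_level_set[OF \<mu> \<Omega> _ u g fin]) auto
    also have "1 / (2 powr of_int k - 2 powr (of_int k - 1)) = 2 powr (1 - of_int k :: real)"
      by (simp add: powr_diff field_simps)
    finally show ?thesis .
  qed
  have term_le: "ennreal (2 powr ((of_int k + 1) * q)) * \<nu> (F k)
      \<le> ennreal (4 powr q * C powr (q / p)) * a k epowr (q / p)" for k
  proof -
    have "\<nu> (F k) = (\<nu> (F k) epowr (p / q)) epowr (q / p)"
      using pq q by (simp add: epowr_epowr)
    also have "\<dots> \<le> (ennreal C * (ennreal (2 powr (1 - of_int k)) epowr p * a k)) epowr (q / p)"
      using pq q by (intro epowr_mono level) auto
    also have "\<dots> = ennreal (C powr (q / p)) * (ennreal (2 powr ((1 - of_int k) * q)) * a k epowr (q / p))"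
      using C pq by (simp add: epowr_mult epowr_epowr epowr_ennreal powr_powr)
    finally have "ennreal (2 powr ((of_int k + 1) * q)) * \<nu> (F k) \<le> ennreal (2 powr ((of_int k + 1) * q)) *
        (ennreal (C powr (q / p)) * (ennreal (2 powr ((1 - of_int k) * q)) * a k epowr (q / p)))"
      by (intro mult_left_mono) auto
    also have "\<dots> = ennreal (2 powr ((of_int k + 1) * q) * 2 powr ((1 - of_int k) * q) * C powr (q / p)) * a k epowr (q / p)"
      by (simp add: ennreal_mult mult_ac)
    also have "2 powr ((of_int k + 1) * q) * 2 powr ((1 - of_int k) * q) = (4 :: real) powr q"
    proof -
      have "2 powr ((of_int k + 1) * q) * 2 powr ((1 - of_int k) * q) = (2 :: real) powr (2 * q)"
        by (simp add: powr_add[symmetric] algebra_simps)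
      also have "\<dots> = (2 powr 2) powr q"
        by (simp only: powr_powr)
      finally show ?thesis by simp
    qed
    finally show ?thesis .
  qed
  have "(\<integral>\<^sup>+ x \<in> \<Omega>. ennreal \<bar>u x\<bar> epowr q \<partial>caratheodory_measure \<nu>)
      \<le> (\<integral>\<^sup>+k. ennreal (2 powr ((of_int k + 1) * q)) * \<nu> (F k) \<partial>count_space (UNIV :: int set))"
    unfolding F_def using q by (intro nn_integral_dyadic_le \<nu> \<Omega> cont) auto
  also have "\<dots> \<le> (\<integral>\<^sup>+k. ennreal (4 powr q * C powr (q / p)) * a k epowr (q / p) \<partial>count_space UNIV)"
    by (intro nn_integral_mono term_le)
  also have "\<dots> = ennreal (4 powr q * C powr (q / p)) * (\<integral>\<^sup>+k. a k epowr (q / p) \<partial>count_space UNIV)"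
    by (rule nn_integral_cmult) simp
  also have "\<dots> \<le> ennreal (4 powr q * C powr (q / p)) * S epowr (q / p)"
  proof (intro mult_left_mono)
    have "(\<integral>\<^sup>+k. a k epowr (q / p) \<partial>count_space UNIV) \<le> (\<integral>\<^sup>+k. a k \<partial>count_space UNIV) epowr (q / p)"
      using pq by (intro nn_integral_count_space_epowr_le) simp
    also have "\<dots> \<le> S epowr (q / p)"
      unfolding a_def S_def using pq q
      by (intro epowr_mono level_sets_energy_sum_le \<mu> \<Omega> cont weak_upper_gradient_measurable[OF g]) auto
    finally show "(\<integral>\<^sup>+k. a k epowr (q / p) \<partial>count_space UNIV) \<le> S epowr (q / p)" .
  qed simp
  finally have "(\<integral>\<^sup>+ x \<in> \<Omega>. ennreal \<bar>u x\<bar> epowr q \<partial>caratheodory_measure \<nu>) epowr (1 / q)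
      \<le> (ennreal (4 powr q * C powr (q / p)) * S epowr (q / p)) epowr (1 / q)"
    using q by (intro epowr_mono) auto
  also have "\<dots> = ennreal ((4 powr q * C powr (q / p)) powr (1 / q)) * S epowr (1 / p)"
    using q by (simp add: epowr_mult epowr_epowr epowr_ennreal)
  also have "(4 powr q * C powr (q / p)) powr (1 / q) = 4 * C powr (1 / p)"
    using q C by (simp add: powr_mult powr_powr)
  finally show ?thesis
    by (simp add: S_def)
qed

text \<open>A competitor is only nonpositive outside \<open>G\<close>, so the Sobolev inequality is applied to its positive
  part. Taking positive parts is a contraction, hence preserves weak upper gradients.\<close>

lemma le_energy_of_admissible:
  fixes \<mu> \<nu> :: "'a::metric_space set \<Rightarrow> ennreal"
  assumes \<mu>: "borel_regular_outer_measure \<mu>" and \<nu>: "borel_regular_outer_measure \<nu>"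
    and \<Omega>: "open \<Omega>" and pq: "0 < p" "0 < q" and c: "0 \<le> c"
    and sobolev: "\<And>u g. u \<in> N1p_cont \<mu> p \<Omega> \<Longrightarrow> (\<And>x. x \<in> \<Omega> - G \<Longrightarrow> u x = 0) \<Longrightarrow>
      g \<in> weak_upper_gradients \<mu> p \<Omega> (\<lambda>x. ereal (u x)) \<Longrightarrow>
      (\<integral>\<^sup>+ x \<in> \<Omega>. ennreal \<bar>u x\<bar> epowr q \<partial>caratheodory_measure \<nu>) epowr (1 / q)
      \<le> ennreal c * energy \<mu> p \<Omega> g epowr (1 / p)"
    and F: "closedin (top_of_set \<Omega>) F"
    and u: "u \<in> admissible \<mu> p F G \<Omega>" and g: "g \<in> weak_upper_gradients \<mu> p \<Omega> (\<lambda>x. ereal (u x))"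
  shows "\<nu> F epowr (p / q) \<le> ennreal (c powr p) * energy \<mu> p \<Omega> g"
proof -
  define v where "v x = max 0 (u x)" for x
  have contr: "\<bar>v x - v y\<bar> \<le> \<bar>u x - u y\<bar>" for x y
    by (simp add: v_def max_def)
  have v_grad: "h \<in> weak_upper_gradients \<mu> p \<Omega> (\<lambda>x. ereal (v x))"
    if "h \<in> weak_upper_gradients \<mu> p \<Omega> (\<lambda>x. ereal (u x))" for h
    using that contr by (rule weak_upper_gradient_contraction)
  have uN: "u \<in> N1p_cont \<mu> p \<Omega>" and u1: "\<And>x. x \<in> F \<Longrightarrow> 1 \<le> u x"
    and u0: "\<And>x. x \<in> \<Omega> - G \<Longrightarrow> u x \<le> 0"
    using u by (auto simp: admissible_def)
  have "v \<in> N1p_cont \<mu> p \<Omega>"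
    unfolding N1p_cont_iff[OF \<mu> \<Omega>]
  proof (intro conjI)
    show "continuous_on \<Omega> v"
      unfolding v_def[abs_def]
      using uN N1p_cont_iff[OF \<mu> \<Omega>] by (intro continuous_intros) auto
    show "\<exists>h\<in>weak_upper_gradients \<mu> p \<Omega> (\<lambda>x. ereal (v x)). energy \<mu> p \<Omega> h < top"
      using uN N1p_cont_iff[OF \<mu> \<Omega>] v_grad by blast
    have "energy \<mu> p \<Omega> (\<lambda>x. ennreal \<bar>v x\<bar>) \<le> energy \<mu> p \<Omega> (\<lambda>x. ennreal \<bar>u x\<bar>)"
      using pq by (intro energy_mono ennreal_leI) (auto simp: v_def)
    also have "\<dots> < top"
      using uN N1p_cont_iff[OF \<mu> \<Omega>] by blast
    finally show "energy \<mu> p \<Omega> (\<lambda>x. ennreal \<bar>v x\<bar>) < top" .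
  qed
  then have sob: "(\<integral>\<^sup>+ x \<in> \<Omega>. ennreal \<bar>v x\<bar> epowr q \<partial>caratheodory_measure \<nu>) epowr (1 / q)
      \<le> ennreal c * energy \<mu> p \<Omega> g epowr (1 / p)"
  proof (rule sobolev)
    show "g \<in> weak_upper_gradients \<mu> p \<Omega> (\<lambda>x. ereal (v x))"
      using g by (rule v_grad)
    show "v x = 0" if "x \<in> \<Omega> - G" for x
      using u0[OF that] by (simp add: v_def)
  qed
  have FB: "F \<in> sets borel"
    using \<Omega> F by (rule closedin_open_borel)
  have "F \<subseteq> \<Omega>"
    using F by (auto dest: closedin_imp_subset)
  have "\<nu> F = (\<integral>\<^sup>+ x. indicator F x \<partial>caratheodory_measure \<nu>)"
    using borel_sets_caratheodory_measure[OF \<nu> FB] emeasure_caratheodory_measure[OF \<nu> FB] by simp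
  also have "\<dots> \<le> (\<integral>\<^sup>+ x \<in> \<Omega>. ennreal \<bar>v x\<bar> epowr q \<partial>caratheodory_measure \<nu>)"
  proof (rule nn_integral_mono)
    fix x
    show "indicator F x \<le> ennreal \<bar>v x\<bar> epowr q * indicator \<Omega> x"
    proof (cases "x \<in> F")
      case True
      then have "1 \<le> \<bar>v x\<bar> powr q"
        using u1[of x] pq by (intro ge_one_powr_ge_zero) (auto simp: v_def)
      then show ?thesis
        using True \<open>F \<subseteq> \<Omega>\<close> by (auto simp: epowr_ennreal)
    qed simp
  qed
  finally have "\<nu> F epowr (p / q) \<le> (\<integral>\<^sup>+ x \<in> \<Omega>. ennreal \<bar>v x\<bar> epowr q \<partial>caratheodory_measure \<nu>) epowr (p / q)"
    using pq by (intro epowr_mono) auto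
  also have "\<dots> = ((\<integral>\<^sup>+ x \<in> \<Omega>. ennreal \<bar>v x\<bar> epowr q \<partial>caratheodory_measure \<nu>) epowr (1 / q)) epowr p"
    by (simp add: epowr_epowr)
  also have "\<dots> \<le> (ennreal c * energy \<mu> p \<Omega> g epowr (1 / p)) epowr p"
    using pq sob by (intro epowr_mono) auto
  also have "\<dots> = ennreal (c powr p) * energy \<mu> p \<Omega> g"
    using pq c by (simp add: epowr_mult epowr_epowr epowr_ennreal)
  finally show ?thesis .
qed

lemma bounded_finite_measure:
  fixes \<mu> :: "'a::metric_space set \<Rightarrow> ennreal"
  assumes \<mu>: "metric_measure \<mu>" and "open \<Omega>" "bounded \<Omega>"
  shows "\<mu> \<Omega> < top"
proof -
  fix x0 :: 'a
  have \<mu>r: "borel_regular_outer_measure \<mu>"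
    using \<mu> by (simp add: metric_measure_def)
  obtain r where r: "0 < r" "\<Omega> \<subseteq> ball x0 r"
    using bounded_subset_ballD[OF \<open>bounded \<Omega>\<close>] by blast
  have "\<mu> \<Omega> = emeasure (caratheodory_measure \<mu>) \<Omega>"
    using \<open>open \<Omega>\<close> by (simp add: emeasure_caratheodory_measure[OF \<mu>r])
  also have "\<dots> \<le> emeasure (caratheodory_measure \<mu>) (ball x0 r)"
    by (intro emeasure_mono r borel_sets_caratheodory_measure[OF \<mu>r]) simp
  also have "\<dots> = \<mu> (ball x0 r)"
    by (simp add: emeasure_caratheodory_measure[OF \<mu>r])
  also have "\<dots> < top"
    using \<mu> r by (simp add: metric_measure_def)
  finally show ?thesis .
qed

lemma lipschitz_weak_upper_gradient:
  fixes v :: "'a::metric_space \<Rightarrow> real"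
  assumes "\<And>x y. \<bar>v x - v y\<bar> \<le> dist x y"
  shows "(\<lambda>_. 1) \<in> weak_upper_gradients \<mu> p \<Omega> (\<lambda>x. ereal (v x))"
proof (rule weak_upper_gradientI)
  fix \<gamma> :: "real \<Rightarrow> 'a" and a b
  assume path: "(\<gamma>, a, b) \<in> paths_in \<Omega>"
  have "ennreal \<bar>v (\<gamma> a) - v (\<gamma> b)\<bar> \<le> ennreal (dist (\<gamma> a) (\<gamma> b))"
    by (intro ennreal_leI assms)
  also have "\<dots> \<le> curve_length a b \<gamma>"
    using paths_in_le[OF path] by (intro dist_le_curve_length) auto
  also have "\<dots> = path_integral (\<lambda>_. 1) (\<gamma>, a, b)"
    using path by (subst path_integral_const) (auto simp: paths_in_def)
  finally show "upper_gradient_ineq (\<lambda>x. ereal (v x)) (\<lambda>_. 1) (\<gamma>, a, b)"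
    by simp
qed simp

text \<open>The distance to the complement of \<open>G\<close>, cut off at 1, is 1-Lipschitz and positive exactly on the
  open set \<open>G\<close>. It has finite energy because the bounded set \<open>\<Omega>\<close> has finite measure.\<close>

lemma null_if_sobolev_zero:
  fixes \<mu> \<nu> :: "'a::metric_space set \<Rightarrow> ennreal"
  assumes \<mu>: "metric_measure \<mu>" and \<nu>: "borel_regular_outer_measure \<nu>"
    and \<Omega>: "open \<Omega>" "bounded \<Omega>" and G: "open G" "G \<subseteq> \<Omega>" and pq: "0 < p" "0 < q"
    and sobolev: "\<And>u g. u \<in> N1p_cont \<mu> p \<Omega> \<Longrightarrow> (\<And>x. x \<in> \<Omega> - G \<Longrightarrow> u x = 0) \<Longrightarrow>
      g \<in> weak_upper_gradients \<mu> p \<Omega> (\<lambda>x. ereal (u x)) \<Longrightarrow>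
      (\<integral>\<^sup>+ x \<in> \<Omega>. ennreal \<bar>u x\<bar> epowr q \<partial>caratheodory_measure \<nu>) = 0"
  shows "\<nu> G = 0"
proof -
  have \<mu>r: "borel_regular_outer_measure \<mu>"
    using \<mu> by (simp add: metric_measure_def)
  \<comment> \<open>The distance to the empty set is 0 by convention, so \<open>G = UNIV\<close> is treated separately.\<close>
  define v where "v x = (if - G = {} then 1 else min 1 (infdist x (- G)))" for x
  have lip: "\<bar>v x - v y\<bar> \<le> dist x y" for x y
    using infdist_triangle_abs[of x "- G" y] by (auto simp: v_def min_def)
  have v0: "v x = 0 \<longleftrightarrow> x \<notin> G" for x
    using in_closed_iff_infdist_zero[of "- G" x] G(1) by (auto simp: v_def min_def closed_def)
  have v1: "\<bar>v x\<bar> \<le> 1" for x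
    using infdist_nonneg[of x "- G"] by (auto simp: v_def)
  have cont: "continuous_on A v" for A
    unfolding v_def[abs_def] by (cases "- G = {}") (auto intro!: continuous_intros)
  have grad: "(\<lambda>_. 1) \<in> weak_upper_gradients \<mu> p \<Omega> (\<lambda>x. ereal (v x))"
    using lip by (rule lipschitz_weak_upper_gradient)
  have fin: "energy \<mu> p \<Omega> (\<lambda>_. 1) < top"
  proof -
    have "(1 :: ennreal) epowr p = 1"
      using epowr_ennreal[of 1 p] by simp
    then have "energy \<mu> p \<Omega> (\<lambda>_. 1) = \<mu> \<Omega>"
      using \<Omega>(1) borel_sets_caratheodory_measure[OF \<mu>r, of \<Omega>] emeasure_caratheodory_measure[OF \<mu>r, of \<Omega>]
      by (simp add: energy_def)
    then show ?thesis
      using bounded_finite_measure[OF \<mu> \<Omega>] by simp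
  qed
  have "v \<in> N1p_cont \<mu> p \<Omega>"
    unfolding N1p_cont_iff[OF \<mu>r \<Omega>(1)]
  proof (intro conjI cont)
    show "\<exists>g\<in>weak_upper_gradients \<mu> p \<Omega> (\<lambda>x. ereal (v x)). energy \<mu> p \<Omega> g < top"
      using grad fin by blast
    have "energy \<mu> p \<Omega> (\<lambda>x. ennreal \<bar>v x\<bar>) \<le> energy \<mu> p \<Omega> (\<lambda>_. 1)"
      using pq v1 by (intro energy_mono) auto
    then show "energy \<mu> p \<Omega> (\<lambda>x. ennreal \<bar>v x\<bar>) < top"
      using fin by (rule le_less_trans)
  qed
  then have "(\<integral>\<^sup>+ x \<in> \<Omega>. ennreal \<bar>v x\<bar> epowr q \<partial>caratheodory_measure \<nu>) = 0"
    using grad v0 by (intro sobolev) auto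
  moreover have "(\<lambda>x. ennreal \<bar>v x\<bar> epowr q * indicator \<Omega> x) \<in> borel_measurable (caratheodory_measure \<nu>)"
  proof -
    have [measurable]: "v \<in> borel_measurable (restrict_space (caratheodory_measure \<nu>) \<Omega>)"
      using \<Omega>(1) by (intro continuous_on_measurable_caratheodory[OF \<nu> _ cont]) auto
    show ?thesis
      using \<Omega>(1) borel_sets_caratheodory_measure[OF \<nu>, of \<Omega>]
      by (subst borel_measurable_restrict_space_iff_ennreal[symmetric]) auto
  qed
  ultimately have "emeasure (caratheodory_measure \<nu>) {x. ennreal \<bar>v x\<bar> epowr q * indicator \<Omega> x \<noteq> 0} = 0"
    by (simp add: nn_integral_0_iff)
  also have "{x. ennreal \<bar>v x\<bar> epowr q * indicator \<Omega> x \<noteq> 0} = G"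
    using v0 G(2) by (auto simp: epowr_ennreal indicator_def)
  finally show ?thesis
    using G(1) by (simp add: emeasure_caratheodory_measure[OF \<nu>])
qed

theorem theorem4p2:
  fixes \<mu> \<nu> :: "'a::metric_space set \<Rightarrow> ennreal" and \<Omega> G :: "'a set" and p q :: real
  assumes "metric_measure \<mu>"
    and "open \<Omega>" and "bounded \<Omega>"
    and "open G" and "G \<subseteq> \<Omega>"
    and "borel_regular_outer_measure \<nu>"
    and "1 \<le> p" and "p \<le> q"
  shows
    "((\<exists>\<gamma>\<ge>0. \<forall>F. closedin (top_of_set \<Omega>) F \<and> F \<subseteq> G \<longrightarrow>
          \<nu> F epowr (p / q) \<le> ennreal \<gamma> * conductivity \<mu> p F G \<Omega>)
      \<longrightarrow>
      (\<exists>c\<ge>0. \<forall>u \<in> N1p_cont \<mu> p \<Omega>. (\<forall>x\<in>\<Omega> - G. u x = 0) \<longrightarrow>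
          (\<forall>g \<in> weak_upper_gradients \<mu> p \<Omega> (\<lambda>x. ereal (u x)).
             (\<integral>\<^sup>+ x \<in> \<Omega>. ennreal \<bar>u x\<bar> epowr q \<partial>caratheodory_measure \<nu>) epowr (1 / q)
             \<le> ennreal c * (\<integral>\<^sup>+ x \<in> \<Omega>. g x epowr p \<partial>caratheodory_measure \<mu>) epowr (1 / p))))
     \<and>
     (\<forall>c\<ge>0.
        (\<forall>u \<in> N1p_cont \<mu> p \<Omega>. (\<forall>x\<in>\<Omega> - G. u x = 0) \<longrightarrow>
          (\<forall>g \<in> weak_upper_gradients \<mu> p \<Omega> (\<lambda>x. ereal (u x)).
             (\<integral>\<^sup>+ x \<in> \<Omega>. ennreal \<bar>u x\<bar> epowr q \<partial>caratheodory_measure \<nu>) epowr (1 / q)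
             \<le> ennreal c * (\<integral>\<^sup>+ x \<in> \<Omega>. g x epowr p \<partial>caratheodory_measure \<mu>) epowr (1 / p)))
        \<longrightarrow>
        (\<forall>F. closedin (top_of_set \<Omega>) F \<and> F \<subseteq> G \<longrightarrow>
          \<nu> F epowr (p / q) \<le> ennreal (c powr p) * conductivity \<mu> p F G \<Omega>))"
proof (intro conjI impI allI)
  have \<mu>: "borel_regular_outer_measure \<mu>"
    using assms(1) by (simp add: metric_measure_def)
  have pq: "0 < p" "0 < q"
    using assms(7,8) by auto
  assume "\<exists>\<gamma>\<ge>0. \<forall>F. closedin (top_of_set \<Omega>) F \<and> F \<subseteq> G \<longrightarrow>
          \<nu> F epowr (p / q) \<le> ennreal \<gamma> * conductivity \<mu> p F G \<Omega>"
  then obtain \<gamma> where "0 \<le> \<gamma>" and \<gamma>: "\<And>F. closedin (top_of_set \<Omega>) F \<Longrightarrow> F \<subseteq> G \<Longrightarrow>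
          \<nu> F epowr (p / q) \<le> ennreal \<gamma> * conductivity \<mu> p F G \<Omega>"
    by blast
  \<comment> \<open>The constant is made positive, so that it keeps an infinite right-hand side infinite.\<close>
  have iso: "\<nu> F epowr (p / q) \<le> ennreal (\<gamma> + 1) * conductivity \<mu> p F G \<Omega>"
    if "closedin (top_of_set \<Omega>) F" "F \<subseteq> G" for F
  proof -
    have "\<nu> F epowr (p / q) \<le> ennreal \<gamma> * conductivity \<mu> p F G \<Omega>"
      using that by (rule \<gamma>)
    also have "\<dots> \<le> ennreal (\<gamma> + 1) * conductivity \<mu> p F G \<Omega>"
      by (intro mult_right_mono ennreal_leI) auto
    finally show ?thesis .
  qed
  show "\<exists>c\<ge>0. \<forall>u \<in> N1p_cont \<mu> p \<Omega>. (\<forall>x\<in>\<Omega> - G. u x = 0) \<longrightarrow>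
          (\<forall>g \<in> weak_upper_gradients \<mu> p \<Omega> (\<lambda>x. ereal (u x)).
             (\<integral>\<^sup>+ x \<in> \<Omega>. ennreal \<bar>u x\<bar> epowr q \<partial>caratheodory_measure \<nu>) epowr (1 / q)
             \<le> ennreal c * (\<integral>\<^sup>+ x \<in> \<Omega>. g x epowr p \<partial>caratheodory_measure \<mu>) epowr (1 / p))"
  proof (intro exI[of _ "4 * (\<gamma> + 1) powr (1 / p)"] conjI ballI impI)
    fix u g
    assume u: "u \<in> N1p_cont \<mu> p \<Omega>" "\<forall>x\<in>\<Omega> - G. u x = 0"
      and g: "g \<in> weak_upper_gradients \<mu> p \<Omega> (\<lambda>x. ereal (u x))"
    have "0 < \<gamma> + 1"
      using \<open>0 \<le> \<gamma>\<close> by simp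
    from capacitary_strong_type_inequality[OF \<mu> assms(6,2) pq(1) assms(8) this iso u(1) _ g] u(2)
    show "(\<integral>\<^sup>+ x \<in> \<Omega>. ennreal \<bar>u x\<bar> epowr q \<partial>caratheodory_measure \<nu>) epowr (1 / q)
        \<le> ennreal (4 * (\<gamma> + 1) powr (1 / p))
          * (\<integral>\<^sup>+ x \<in> \<Omega>. g x epowr p \<partial>caratheodory_measure \<mu>) epowr (1 / p)"
      unfolding energy_def by blast
  qed simp
next
  have \<mu>: "borel_regular_outer_measure \<mu>"
    using assms(1) by (simp add: metric_measure_def)
  have pq: "0 < p" "0 < q"
    using assms(7,8) by auto
  fix c :: real and F
  assume "0 \<le> c" and F: "closedin (top_of_set \<Omega>) F \<and> F \<subseteq> G"
    and sob: "\<forall>u \<in> N1p_cont \<mu> p \<Omega>. (\<forall>x\<in>\<Omega> - G. u x = 0) \<longrightarrow>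
          (\<forall>g \<in> weak_upper_gradients \<mu> p \<Omega> (\<lambda>x. ereal (u x)).
             (\<integral>\<^sup>+ x \<in> \<Omega>. ennreal \<bar>u x\<bar> epowr q \<partial>caratheodory_measure \<nu>) epowr (1 / q)
             \<le> ennreal c * (\<integral>\<^sup>+ x \<in> \<Omega>. g x epowr p \<partial>caratheodory_measure \<mu>) epowr (1 / p))"
  have sobolev: "(\<integral>\<^sup>+ x \<in> \<Omega>. ennreal \<bar>u x\<bar> epowr q \<partial>caratheodory_measure \<nu>) epowr (1 / q)
      \<le> ennreal c * energy \<mu> p \<Omega> g epowr (1 / p)"
    if "u \<in> N1p_cont \<mu> p \<Omega>" "\<And>x. x \<in> \<Omega> - G \<Longrightarrow> u x = 0"
      "g \<in> weak_upper_gradients \<mu> p \<Omega> (\<lambda>x. ereal (u x))" for u g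
    unfolding energy_def using sob that by blast
  show "\<nu> F epowr (p / q) \<le> ennreal (c powr p) * conductivity \<mu> p F G \<Omega>"
  proof (cases "c = 0")
    case True
    \<comment> \<open>Without competitors the conductivity is infinite, but its product with 0 is 0.\<close>
    have "\<nu> G = 0"
    proof (rule null_if_sobolev_zero[OF assms(1,6,2,3,4,5) pq])
      fix u g
      assume "u \<in> N1p_cont \<mu> p \<Omega>" "\<And>x. x \<in> \<Omega> - G \<Longrightarrow> u x = 0"
        "g \<in> weak_upper_gradients \<mu> p \<Omega> (\<lambda>x. ereal (u x))"
      from sobolev[OF this] True
      have "(\<integral>\<^sup>+ x \<in> \<Omega>. ennreal \<bar>u x\<bar> epowr q \<partial>caratheodory_measure \<nu>) epowr (1 / q) = 0"
        by simp
      then have "((\<integral>\<^sup>+ x \<in> \<Omega>. ennreal \<bar>u x\<bar> epowr q \<partial>caratheodory_measure \<nu>) epowr (1 / q)) epowr q = 0"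
        by simp
      then show "(\<integral>\<^sup>+ x \<in> \<Omega>. ennreal \<bar>u x\<bar> epowr q \<partial>caratheodory_measure \<nu>) = 0"
        using pq by (simp add: epowr_epowr)
    qed
    moreover have "\<nu> F \<le> \<nu> G"
      using assms(6) F by (auto simp: borel_regular_outer_measure_def outer_measure_space_def increasing_def)
    ultimately show ?thesis
      by simp
  next
    case False
    then have C: "0 < ennreal (c powr p)"
      using \<open>0 \<le> c\<close> by simp
    have "\<nu> F epowr (p / q) / ennreal (c powr p) \<le> conductivity \<mu> p F G \<Omega>"
      unfolding conductivity_def
    proof (intro INF_greatest divide_le_posI_ennreal C)
      fix u g
      assume "u \<in> admissible \<mu> p F G \<Omega>" "g \<in> weak_upper_gradients \<mu> p \<Omega> (\<lambda>x. ereal (u x))"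
      then show "\<nu> F epowr (p / q) \<le> ennreal (c powr p) * energy \<mu> p \<Omega> g"
        using le_energy_of_admissible[OF \<mu> assms(6,2) pq \<open>0 \<le> c\<close> sobolev] F by blast
    qed
    then have "ennreal (c powr p) * (\<nu> F epowr (p / q) / ennreal (c powr p))
        \<le> ennreal (c powr p) * conductivity \<mu> p F G \<Omega>"
      by (intro mult_left_mono) auto
    then show ?thesis
      using C by (simp add: ennreal_times_divide mult.commute[of _ "\<nu> F epowr (p / q)"] mult_divide_eq_ennreal)
  qed
qed

end
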